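(* Let $2\le r<s\le k$ be fixed integers, and let $\ell=\ell_k(r,s)$ be the smallest integer $\ell\ge0$ such that $$k-\ell-r-\frac{k-\ell}{\binom ks-\binom{\ell}{s}}\sum_{j=1}^r\binom{\ell}{s-j}\left[\binom{k-\ell}{j}-\binom rj\right]\le0 .$$ Then there is a strategy $\mathcal S$ such that for every $t=t(n)\gg n^{\,r-\frac{k-\ell}{\binom ks-\binom{\ell}s}}$, a.a.s. $G^{(r,s)}_t$ contains a copy of the complete $s$-uniform hypergraph $K_k^{(s)}$. Thus $\tau^{(r)}(K_k^{(s)})\le n^{\,r-\frac{k-\ell}{\binom ks-\binom{\ell}s}}$.
   Context: Semi-random hypergraph process: fix integers $1\le r<s$ and $n\ge s$. Start with the empty $s$-uniform multi-hypergraph $G_0^{(r,s)}$ on $[n]$. In each step $t\ge1$, a set $U_t$ of $r$ vertices is chosen uniformly at random among all $r$-subsets of $[n]$, independently of all previous choices; the player chooses an $(s-r)$-set $V_t\subseteq[n]\setminus U_t$, and the edge $U_t\cup V_t$ is added to form $G^{(r,s)}_t$ (parallel edges allowed). A strategy is, for each $n$, a sequence of functions determining $V_t$ from $(U_1,V_1,\dots,U_{t-1},V_{t-1},U_t)$. A.a.s. means with probability $\to1$ as $n\to\infty$; $a_n\gg b_n$ means $b_n=o(a_n)$. $K_k^{(s)}$ is the $s$-uniform hypergraph on $k$ vertices having all $\binom ks$ $s$-subsets as edges. Binomial coefficients $\binom{a}{b}$ with $0\le a<b$ are $0$. *)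

theory Defs
  imports "HOL-Library.Landau_Symbols"
begin

definition rsets :: "nat \<Rightarrow> nat \<Rightarrow> nat set set" where
  "rsets n r = {U. U \<subseteq> {1..n} \<and> card U = r}"

text \<open>A strategy: given n, the history ((U_1,V_1),...,(U_{t-1},V_{t-1})) and U_t, it returns V_t.\<close>
type_synonym strategy = "nat \<Rightarrow> (nat set \<times> nat set) list \<Rightarrow> nat set \<Rightarrow> nat set"

definition valid_strategy :: "nat \<Rightarrow> nat \<Rightarrow> strategy \<Rightarrow> bool" where
  "valid_strategy r s S \<longleftrightarrow>
     (\<forall>n h U. s \<le> n \<longrightarrow> U \<in> rsets n r \<longrightarrow>
        S n h U \<subseteq> {1..n} - U \<and> card (S n h U) = s - r)"

definition history :: "strategy \<Rightarrow> nat \<Rightarrow> nat set list \<Rightarrow> (nat set \<times> nat set) list" where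
  "history S n Us = foldl (\<lambda>h U. h @ [(U, S n h U)]) [] Us"

text \<open>The edges (as a list, i.e. multi-hypergraph) of G_t.\<close>
definition edges_of :: "strategy \<Rightarrow> nat \<Rightarrow> nat set list \<Rightarrow> nat set list" where
  "edges_of S n Us = map (\<lambda>(U, V). U \<union> V) (history S n Us)"

definition contains_clique :: "nat \<Rightarrow> nat \<Rightarrow> nat \<Rightarrow> nat set list \<Rightarrow> bool" where
  "contains_clique n k s E \<longleftrightarrow>
     (\<exists>K. K \<subseteq> {1..n} \<and> card K = k \<and> (\<forall>e. e \<subseteq> K \<and> card e = s \<longrightarrow> e \<in> set E))"

text \<open>Probability that G_t^{(r,s)} (under strategy S, n vertices) contains K_k^(s):
  U_1,...,U_t are independent uniform r-subsets of [n], i.e. the tuple is uniform on (rsets n r)^t.\<close>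
definition clique_prob :: "nat \<Rightarrow> nat \<Rightarrow> nat \<Rightarrow> strategy \<Rightarrow> nat \<Rightarrow> nat \<Rightarrow> real" where
  "clique_prob r s k S n t =
     real (card {Us. length Us = t \<and> set Us \<subseteq> rsets n r \<and> contains_clique n k s (edges_of S n Us)})
     / real (card {Us. length Us = t \<and> set Us \<subseteq> rsets n r})"

definition ell_expr :: "nat \<Rightarrow> nat \<Rightarrow> nat \<Rightarrow> nat \<Rightarrow> real" where
  "ell_expr k r s l =
     real k - real l - real r
     - (real k - real l) / (real (k choose s) - real (l choose s))
       * (\<Sum>j=1..r. real (l choose (s - j)) * (real ((k - l) choose j) - real (r choose j)))"

definition ell :: "nat \<Rightarrow> nat \<Rightarrow> nat \<Rightarrow> nat" where
  "ell k r s = (LEAST l. ell_expr k r s l \<le> 0)"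

end

theory Submission
  imports Defs "HOL-Analysis.Convex"
begin

text \<open>
  Write \<open>m = k - \<ell>\<close>, let \<open>\<theta>\<close> be the fraction in the exponent, and suppose that a clique on an
  \<open>\<ell>\<close>-set \<open>L\<close> is already present. Each missing edge of a clique on \<open>L\<close> plus \<open>m\<close> new vertices
  gets its own block of about \<open>n\<close> to the power \<open>r - \<theta>\<close> steps and a designated \<open>r\<close>-subset that
  has to be hit in this block, which happens with probability about \<open>n\<close> to the power \<open>-\<theta>\<close>.
  First come the edges with at most \<open>r\<close> new vertices: the designated set contains all of these,
  so the player completes it inside \<open>L\<close> without knowing the other new vertices. The inequality
  defining \<open>\<ell>\<close> and the convexity of binomial coefficients say that, on average, a fixed \<open>r\<close>-set
  of new vertices then has a bounded number of extensions. Hence a positive proportion of the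
  half-finished cliques share fewer than \<open>r\<close> new vertices with any other one, and in the
  remaining blocks an \<open>r\<close>-set that is hit tells the player which of them to continue. The
  expected number of finished cliques has constant order, and by a second moment estimate the
  success probability is bounded below. The clique on \<open>L\<close> is built recursively, and convexity
  shows that this takes no longer. Finally, restarting the strategy over and over turns a
  constant success probability into one that tends to 1, without knowing \<open>t\<close> in advance.
\<close>

subsection \<open>Averages over words\<close>

definition words :: "'a set \<Rightarrow> nat \<Rightarrow> 'a list set" where
  "words R t = {xs. length xs = t \<and> set xs \<subseteq> R}"

definition avg :: "'a set \<Rightarrow> nat \<Rightarrow> ('a list \<Rightarrow> real) \<Rightarrow> real" where
  "avg R t f = (\<Sum>xs\<in>words R t. f xs) / real (card R) ^ t"

definition block :: "nat \<Rightarrow> nat \<Rightarrow> 'a list \<Rightarrow> 'a list" where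
  "block T i xs = take T (drop (i * T) xs)"

lemma words_0 [simp]: "words R 0 = {[]}"
  by (auto simp: words_def)

lemma finite_words [simp]: "finite R \<Longrightarrow> finite (words R t)"
  using finite_lists_length_eq[of R t] by (simp add: words_def conj_commute)

lemma card_words: "finite R \<Longrightarrow> card (words R t) = card R ^ t"
  using card_lists_length_eq[of R t] by (simp add: words_def conj_commute)

lemma avg_cong: "(\<And>xs. xs \<in> words R t \<Longrightarrow> f xs = g xs) \<Longrightarrow> avg R t f = avg R t g"
  by (simp add: avg_def)

lemma avg_mono: "(\<And>xs. xs \<in> words R t \<Longrightarrow> f xs \<le> g xs) \<Longrightarrow> avg R t f \<le> avg R t g"
  unfolding avg_def by (intro divide_right_mono sum_mono) auto

lemma avg_nonneg: "(\<And>xs. xs \<in> words R t \<Longrightarrow> 0 \<le> f xs) \<Longrightarrow> 0 \<le> avg R t f"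
  unfolding avg_def by (intro divide_nonneg_nonneg sum_nonneg) auto

lemma avg_cmult: "avg R t (\<lambda>xs. c * f xs) = c * avg R t f"
  by (simp add: avg_def sum_distrib_left)

lemma avg_cmult_right: "avg R t (\<lambda>xs. f xs * c) = avg R t f * c"
  by (simp add: avg_def sum_distrib_right)

lemma avg_add: "avg R t (\<lambda>xs. f xs + g xs) = avg R t f + avg R t g"
  by (simp add: avg_def sum.distrib add_divide_distrib)

lemma avg_diff: "avg R t (\<lambda>xs. f xs - g xs) = avg R t f - avg R t g"
  by (simp add: avg_def sum_subtractf diff_divide_distrib)

lemma avg_sum: "avg R t (\<lambda>xs. \<Sum>i\<in>I. f i xs) = (\<Sum>i\<in>I. avg R t (f i))"
  by (simp add: avg_def sum_divide_distrib) (rule sum.swap)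

lemma avg_const: "finite R \<Longrightarrow> R \<noteq> {} \<Longrightarrow> avg R t (\<lambda>xs. c) = c"
  by (simp add: avg_def card_words)

text \<open>A uniform word is a pair of independent uniform words, so this is Fubini. It is the way
  to condition on the first \<open>a\<close> draws.\<close>

lemma avg_append: "avg R (a + b) f = avg R a (\<lambda>xs. avg R b (\<lambda>ys. f (xs @ ys)))"
proof -
  have "bij_betw (\<lambda>(xs, ys). xs @ ys) (words R a \<times> words R b) (words R (a + b))"
  proof (rule bij_betwI[where g = "\<lambda>zs. (take a zs, drop a zs)"])
    show "(\<lambda>(xs, ys). xs @ ys) \<in> words R a \<times> words R b \<rightarrow> words R (a + b)"
      by (auto simp: words_def)
    show "(\<lambda>zs. (take a zs, drop a zs)) \<in> words R (a + b) \<rightarrow> words R a \<times> words R b"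
      by (auto simp: words_def dest: in_set_takeD in_set_dropD)
  qed (auto simp: words_def)
  then have "(\<Sum>zs\<in>words R (a + b). f zs) = (\<Sum>(xs, ys)\<in>words R a \<times> words R b. f (xs @ ys))"
    by (subst sum.reindex_bij_betw[symmetric]) (auto simp: case_prod_unfold)
  then show ?thesis
    by (simp add: avg_def sum.cartesian_product power_add sum_divide_distrib[symmetric])
qed

text \<open>Disjoint blocks of a uniform word are independent; the induction splits off the last
  block.\<close>

lemma avg_prod_block:
  "avg R (D * T) (\<lambda>xs. \<Prod>i<D. g i (block T i xs)) = (\<Prod>i<D. avg R T (g i))"
proof (induction D)
  case 0
  then show ?case by (simp add: avg_def)
next
  case (Suc D)
  have split: "Suc D * T = D * T + T" by simp
  have "avg R (Suc D * T) (\<lambda>xs. \<Prod>i<Suc D. g i (block T i xs))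
      = avg R (D * T) (\<lambda>xs. avg R T (\<lambda>ys. (\<Prod>i<D. g i (block T i xs)) * g D ys))"
    unfolding split avg_append
  proof (intro avg_cong)
    fix xs ys
    assume xs: "xs \<in> words R (D * T)" and ys: "ys \<in> words R T"
    have "block T i (xs @ ys) = block T i xs" if "i < D" for i
    proof -
      have "i * T + T \<le> D * T"
        using mult_le_mono1[of "Suc i" D T] that by simp
      then show ?thesis using xs by (simp add: block_def words_def)
    qed
    moreover have "block T D (xs @ ys) = ys"
      using xs ys by (simp add: block_def words_def)
    ultimately show "(\<Prod>i<Suc D. g i (block T i (xs @ ys)))
        = (\<Prod>i<D. g i (block T i xs)) * g D ys"
      by simp
  qed
  also have "\<dots> = (\<Prod>i<Suc D. avg R T (g i))"
    using Suc.IH by (simp add: avg_cmult avg_cmult_right)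
  finally show ?case .
qed

text \<open>Since \<open>Y\<close> vanishes where \<open>P\<close> fails, it equals its product with
  the indicator of \<open>P\<close>, and Cauchy-Schwarz applies. With \<open>Y\<close> a count of
  good structures, this is the second moment bound on the probability that one exists.\<close>

lemma avg_Cauchy_Schwarz:
  assumes "\<And>xs. xs \<in> words R t \<Longrightarrow> \<not> P xs \<Longrightarrow> Y xs = 0"
  shows "(avg R t Y)\<^sup>2 \<le> avg R t (\<lambda>xs. of_bool (P xs)) * avg R t (\<lambda>xs. (Y xs)\<^sup>2)"
proof -
  have "(\<Sum>xs\<in>words R t. Y xs) = (\<Sum>xs\<in>words R t. of_bool (P xs) * Y xs)"
    by (intro sum.cong) (auto simp: assms)
  then have "(\<Sum>xs\<in>words R t. Y xs)\<^sup>2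
      \<le> (\<Sum>xs\<in>words R t. (of_bool (P xs))\<^sup>2) * (\<Sum>xs\<in>words R t. (Y xs)\<^sup>2)"
    using Cauchy_Schwarz_ineq_sum[of "\<lambda>xs. of_bool (P xs)" Y "words R t"] by simp
  then have "(\<Sum>xs\<in>words R t. Y xs)\<^sup>2
      \<le> (\<Sum>xs\<in>words R t. of_bool (P xs)) * (\<Sum>xs\<in>words R t. (Y xs)\<^sup>2)"
    by (simp add: power2_eq_square flip: of_bool_conj)
  then show ?thesis
    by (simp add: avg_def power_divide power2_eq_square[of "_ ^ _"] divide_right_mono
        del: sum_of_bool_eq)
qed

section \<open>Hitting fixed points with independent draws\<close>

definition hit_prob :: "real \<Rightarrow> nat \<Rightarrow> real" where
  "hit_prob N T = 1 - (1 - 1 / N) ^ T"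

lemma avg_avoid:
  assumes "finite R" "R \<noteq> {}" "B \<subseteq> R"
  shows "avg R T (\<lambda>xs. of_bool (set xs \<inter> B = {})) = (1 - real (card B) / real (card R)) ^ T"
proof -
  have "words R T \<inter> {xs. set xs \<inter> B = {}} = words (R - B) T"
    by (auto simp: words_def)
  then have "(\<Sum>xs\<in>words R T. of_bool (set xs \<inter> B = {})) = real (card (words (R - B) T))"
    using assms by (simp add: sum.If_cases of_bool_def)
  also have "\<dots> = (real (card R) - real (card B)) ^ T"
    using assms by (simp add: card_words card_Diff_subset finite_subset card_mono of_nat_diff)
  finally show ?thesis
    using assms by (simp add: avg_def diff_divide_distrib flip: power_divide)
qed

lemma avg_hit:
  assumes "finite R" "a \<in> R"
  shows "avg R T (\<lambda>xs. of_bool (a \<in> set xs)) = hit_prob (card R) T"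
proof -
  have "avg R T (\<lambda>xs. of_bool (a \<in> set xs)) = avg R T (\<lambda>xs. 1 - of_bool (set xs \<inter> {a} = {}))"
    by (intro avg_cong) auto
  also have "\<dots> = hit_prob (card R) T"
  proof -
    have "R \<noteq> {}" using assms by auto
    then show ?thesis
      unfolding avg_diff
      using assms avg_avoid[of R "{a}" T] avg_const[of R T 1] by (simp add: hit_prob_def)
  qed
  finally show ?thesis .
qed

text \<open>Inclusion-exclusion and 1 - 2/N <= (1 - 1/N)^2: hitting two distinct points with the
  same draws is negatively correlated.\<close>

lemma avg_hit_two_le:
  assumes "finite R" "a \<in> R" "b \<in> R" "a \<noteq> b"
  shows "avg R T (\<lambda>xs. of_bool (a \<in> set xs) * of_bool (b \<in> set xs)) \<le> (hit_prob (card R) T)\<^sup>2"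
proof -
  let ?x = "1 - 1 / real (card R)"
  have "card {a, b} \<le> card R"
    using assms by (intro card_mono) auto
  \<comment> \<open>With two points in \<open>R\<close>, the base 1 - 2/N is nonnegative, so taking
    powers preserves the inequality.\<close>
  then have N: "real (card R) \<ge> 2" using assms by simp
  have "avg R T (\<lambda>xs. of_bool (a \<in> set xs) * of_bool (b \<in> set xs))
     = avg R T (\<lambda>xs. 1 - of_bool (set xs \<inter> {a} = {}) - of_bool (set xs \<inter> {b} = {})
              + of_bool (set xs \<inter> {a, b} = {}))"
    by (intro avg_cong) auto
  also have "\<dots> = 1 - ?x ^ T - ?x ^ T + (1 - 2 / real (card R)) ^ T"
  proof -
    have "R \<noteq> {}" using assms by auto
    then show ?thesis
      unfolding avg_diff avg_add
      using assms avg_avoid[of R "{a}" T] avg_avoid[of R "{b}" T] avg_avoid[of R "{a, b}" T]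
        avg_const[of R T 1]
      by simp
  qed
  also have "\<dots> \<le> 1 - ?x ^ T - ?x ^ T + (?x\<^sup>2) ^ T"
  proof -
    have "1 - 2 / real (card R) \<le> ?x\<^sup>2"
      by (simp add: power2_eq_square algebra_simps)
    then show ?thesis using N by (simp add: power_mono)
  qed
  also have "\<dots> = (hit_prob (card R) T)\<^sup>2"
  proof -
    have "1 - y - y + y * y = (1 - y)\<^sup>2" for y :: real
      by (simp add: power2_eq_square algebra_simps)
    then show ?thesis
      unfolding hit_prob_def power2_eq_square[of ?x] power_mult_distrib by blast
  qed
  finally show ?thesis .
qed

text \<open>The upper bound T/N is Bernoulli's inequality. For the lower bound put y = T/N, which
  lies in [0,1], and use (1 - 1/N)^T <= exp(-y) <= 1/(1 + y) <= 1 - y/2.\<close>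

lemma hit_prob_bounds:
  assumes "N \<ge> 1" "real T \<le> N"
  shows "0 \<le> hit_prob N T" "hit_prob N T \<le> 1"
    "hit_prob N T \<le> real T / N" "real T / (2 * N) \<le> hit_prob N T"
proof -
  have x: "0 \<le> 1 - 1 / N" "1 - 1 / N \<le> 1" using assms by auto
  show "0 \<le> hit_prob N T" "hit_prob N T \<le> 1"
    using x by (auto simp: hit_prob_def power_le_one)
  show "hit_prob N T \<le> real T / N"
    using Bernoulli_inequality[of "- (1 / N)" T] x by (simp add: hit_prob_def)
  let ?y = "real T / N"
  have y: "0 \<le> ?y" "?y \<le> 1" using assms by auto
  have "(1 - 1 / N) ^ T \<le> exp (- (1 / N)) ^ T"
    using x exp_ge_add_one_self[of "- (1 / N)"] by (intro power_mono) auto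
  also have "\<dots> = inverse (exp ?y)"
    by (simp add: exp_minus flip: exp_of_nat_mult)
       (simp add: power_inverse flip: exp_of_nat_mult)
  also have "\<dots> \<le> inverse (1 + ?y)"
    using y exp_ge_add_one_self[of ?y] by (intro le_imp_inverse_le) auto
  also have "\<dots> \<le> 1 - ?y / 2"
  proof -
    have "1 \<le> (1 - z / 2) * (1 + z)" if "0 \<le> z" "z \<le> 1" for z :: real
      using mult_left_mono[OF that(2,1)] by (simp add: algebra_simps)
    from this[OF y] have "1 \<le> (1 - ?y / 2) * (1 + ?y)" .
    then show ?thesis using y(1) by (simp add: inverse_eq_divide pos_divide_le_eq)
  qed
  finally show "real T / (2 * N) \<le> hit_prob N T"
    by (simp add: hit_prob_def mult.commute)
qed

subsection \<open>A second moment estimate\<close>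

text \<open>By independence the average factors over the blocks. Each block costs a factor
  \<open>q\<close> for \<open>a i\<close>, and another one only where a different point
  \<open>c i\<close> must be hit too; for equal points the second demand is free.\<close>

lemma avg_hits_le:
  fixes a c :: "nat \<Rightarrow> 'a"
  assumes R: "finite R" "\<And>i. i < D \<Longrightarrow> a i \<in> R" "\<And>i. i < D \<Longrightarrow> c i \<in> R"
    and W: "W \<subseteq> {..<D}" and q: "q = hit_prob (card R) T"
  shows "avg R (D * T) (\<lambda>xs. \<Prod>i<D. of_bool (a i \<in> set (block T i xs)) *
            (if i \<in> W then of_bool (c i \<in> set (block T i xs)) else 1))
       \<le> q ^ (D + card {i \<in> W. a i \<noteq> c i})"
proof -
  let ?g = "\<lambda>i ys. of_bool (a i \<in> set ys) * (if i \<in> W then of_bool (c i \<in> set ys) else 1) :: real"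
  have "avg R (D * T) (\<lambda>xs. \<Prod>i<D. ?g i (block T i xs)) = (\<Prod>i<D. avg R T (?g i))"
    by (rule avg_prod_block)
  also have "\<dots> \<le> (\<Prod>i<D. q * (if i \<in> {i \<in> W. a i \<noteq> c i} then q else 1))"
  proof (rule prod_mono, rule conjI)
    fix i assume i: "i \<in> {..<D}"
    show "0 \<le> avg R T (?g i)" by (rule avg_nonneg) auto
    show "avg R T (?g i) \<le> q * (if i \<in> {i \<in> W. a i \<noteq> c i} then q else 1)"
    proof (cases "i \<in> W \<and> a i \<noteq> c i")
      case True
      then show ?thesis
        using avg_hit_two_le[OF R(1) R(2,3)[of i], of T] i by (simp add: q power2_eq_square)
    next
      case False
      then have "avg R T (?g i) = avg R T (\<lambda>ys. of_bool (a i \<in> set ys))"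
        by (intro avg_cong) auto
      then show ?thesis
        using False avg_hit[OF R(1) R(2)[of i], of T] i by (auto simp: q)
    qed
  qed
  also have "\<dots> = q ^ D * (\<Prod>i\<in>{i \<in> W. a i \<noteq> c i}. q)"
  proof -
    have "{..<D} \<inter> {i \<in> W. a i \<noteq> c i} = {i \<in> W. a i \<noteq> c i}" using W by auto
    then show ?thesis by (simp add: prod.distrib prod.If_cases)
  qed
  finally show ?thesis by (simp add: power_add)
qed

section \<open>Tuples grouped by their common coordinates\<close>

definition agree :: "nat \<Rightarrow> (nat \<Rightarrow> 'a) \<Rightarrow> (nat \<Rightarrow> 'a) \<Rightarrow> nat set" where
  "agree m v w = {j. j < m \<and> v j = w j}"

lemma agree_subset: "agree m v w \<subseteq> {..<m}"
  by (auto simp: agree_def)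

lemma card_agree_less:
  assumes "v \<in> {..<m} \<rightarrow>\<^sub>E B" "w \<in> {..<m} \<rightarrow>\<^sub>E B" "v \<noteq> w"
  shows "card (agree m v w) < m"
proof -
  have "agree m v w \<noteq> {..<m}"
    using assms PiE_ext[of v "{..<m}" "\<lambda>_. B" w] by (auto simp: agree_def)
  then have "agree m v w \<subset> {..<m}" using agree_subset by blast
  then show ?thesis using psubset_card_mono[of "{..<m}"] by simp
qed

text \<open>Sort the tuples \<open>w\<close> by their agreement set \<open>I\<close> with
  \<open>v\<close>: on \<open>I\<close> the tuple is forced, and elsewhere each coordinate has at
  most \<open>b\<close> values.\<close>

lemma sum_agree_le:
  fixes g :: "nat set \<Rightarrow> real"
  assumes "\<And>I. 0 \<le> g I"
  shows "(\<Sum>w\<in>{..<m} \<rightarrow>\<^sub>E {..<b}. g (agree m v w)) \<le> (\<Sum>I\<in>Pow {..<m}. real b ^ (m - card I) * g I)"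
proof -
  let ?V = "{..<m} \<rightarrow>\<^sub>E {..<b}"
  have fin: "finite ?V" by (intro finite_PiE) auto
  have cd: "card {w \<in> ?V. agree m v w = I} \<le> b ^ (m - card I)" if I: "I \<subseteq> {..<m}" for I
  proof -
    have "{w \<in> ?V. agree m v w = I} \<subseteq> (\<Pi>\<^sub>E j\<in>{..<m}. if j \<in> I then {v j} else {..<b})"
      by (auto simp: agree_def PiE_def Pi_def split: if_splits)
    then have "card {w \<in> ?V. agree m v w = I}
        \<le> card (\<Pi>\<^sub>E j\<in>{..<m}. if j \<in> I then {v j} else {..<b})"
      by (intro card_mono finite_PiE) auto
    also have "\<dots> = (\<Prod>j<m. if j \<in> I then 1 else b)"
      by (simp add: card_PiE if_distrib cong: if_cong)
    also have "\<dots> = b ^ card ({..<m} - I)"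
      by (simp add: prod.If_cases Diff_eq)
    also have "card ({..<m} - I) = m - card I"
      using I by (simp add: card_Diff_subset finite_subset)
    finally show ?thesis .
  qed
  have "(\<Sum>w\<in>?V. g (agree m v w)) = (\<Sum>I\<in>Pow {..<m}. \<Sum>w\<in>{w \<in> ?V. agree m v w = I}. g (agree m v w))"
    by (intro sum.group[symmetric] fin) (auto simp: agree_def)
  also have "\<dots> = (\<Sum>I\<in>Pow {..<m}. real (card {w \<in> ?V. agree m v w = I}) * g I)"
    by (intro sum.cong) auto
  also have "\<dots> \<le> (\<Sum>I\<in>Pow {..<m}. real b ^ (m - card I) * g I)"
    using cd assms by (intro sum_mono mult_right_mono) (auto simp flip: of_nat_power)
  finally show ?thesis .
qed

text \<open>
  The tuple \<open>v\<close> encodes the new vertices of a potential clique, \<open>tgt i v\<close> is the set that has to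
  be hit in block \<open>i\<close>, and \<open>Rx i\<close> is the set of coordinates of \<open>v\<close> on which it depends. The
  conclusion is about tuples whose early blocks do not conflict with any other tuple.
\<close>
lemma second_moment:
  fixes tgt :: "nat \<Rightarrow> (nat \<Rightarrow> nat) \<Rightarrow> 'a" and Rx :: "nat \<Rightarrow> nat set" and m b :: nat
  defines "V \<equiv> {..<m} \<rightarrow>\<^sub>E {..<b}"
  assumes R: "finite R" "R \<noteq> {}" "T \<le> card R"
    and tgt: "\<And>i v. i < D \<Longrightarrow> v \<in> V \<Longrightarrow> tgt i v \<in> R"
    and D1: "D1 \<le> D"
    and same: "\<And>i v w. i < D \<Longrightarrow> v \<in> V \<Longrightarrow> w \<in> V \<Longrightarrow> tgt i v = tgt i w \<longleftrightarrow> Rx i \<subseteq> agree m v w"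
    and late: "\<And>i. D1 \<le> i \<Longrightarrow> i < D \<Longrightarrow> r \<le> card (Rx i)"
    and q: "q = hit_prob (card R) T"
    and h: "\<And>I. h I = card {i. i < D1 \<and> Rx i \<subseteq> I}"
    and H1: "\<And>I. I \<subseteq> {..<m} \<Longrightarrow> r \<le> card I \<Longrightarrow> card I < m \<Longrightarrow>
              real b ^ (m - card I) * q ^ (D1 - h I) \<le> 1 / 2 ^ (m + 1)"
    and H2: "\<And>I. I \<subseteq> {..<m} \<Longrightarrow> card I < r \<Longrightarrow> 1 \<le> C * (real b ^ card I * q ^ h I)"
    and C: "0 \<le> C"
    and mu: "\<mu> = real b ^ m * q ^ D" "0 < \<mu>"
  shows "\<mu> / (4 * (1 + 2 ^ m * C * \<mu>)) \<le> avg R (D * T) (\<lambda>xs. of_bool (\<exists>v\<in>V.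
      (\<forall>i<D. tgt i v \<in> set (block T i xs)) \<and>
      (\<forall>w\<in>V. w \<noteq> v \<longrightarrow> r \<le> card (agree m v w) \<longrightarrow> (\<exists>i<D1. tgt i w \<notin> set (block T i xs)))))"
proof -
  define hit where "hit i v xs = (of_bool (tgt i v \<in> set (block T i xs)) :: real)" for i v xs
  \<comment> \<open>A good tuple has all its targets hit, while every other tuple sharing at least
    \<open>r\<close> coordinates with it misses an early target.\<close>
  define good where "good v xs \<longleftrightarrow> (\<forall>i<D. tgt i v \<in> set (block T i xs)) \<and>
      (\<forall>w\<in>V. w \<noteq> v \<longrightarrow> r \<le> card (agree m v w) \<longrightarrow> (\<exists>i<D1. tgt i w \<notin> set (block T i xs)))" for v xs
  \<comment> \<open>Indicator that all targets of \<open>v\<close> are hit, and those of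
    \<open>w\<close> in the blocks of \<open>W\<close>, written as a product so that
    \<open>avg_hits_le\<close> applies.\<close>
  define pr where "pr W v w xs = (\<Prod>i<D. hit i v xs * (if i \<in> W then hit i w xs else 1))" for W v w xs
  define E where "E = avg R (D * T)"
  have finV: "finite V" unfolding V_def by (intro finite_PiE) auto
  have cardV: "real (card V) = real b ^ m"
    unfolding V_def by (simp add: card_funcsetE)
  have q0: "0 \<le> q" "q \<le> 1"
    using hit_prob_bounds(1,2)[of "real (card R)" T] R by (auto simp: q Suc_le_eq card_gt_0_iff)
  have hitsq: "hit i v xs = (if tgt i v \<in> set (block T i xs) then 1 else 0)" for i v xs
    by (simp add: hit_def)
  have pr01: "pr W v w xs = of_bool ((\<forall>i<D. tgt i v \<in> set (block T i xs)) \<and>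
      (\<forall>i<D. i \<in> W \<longrightarrow> tgt i w \<in> set (block T i xs)))" for W v w xs
  proof (cases "(\<forall>i<D. tgt i v \<in> set (block T i xs)) \<and>
      (\<forall>i<D. i \<in> W \<longrightarrow> tgt i w \<in> set (block T i xs))")
    case True
    then have "pr W v w xs = 1" unfolding pr_def by (intro prod.neutral) (auto simp: hitsq)
    then show ?thesis using True by simp
  next
    case False
    then have "\<exists>i\<in>{..<D}. hit i v xs * (if i \<in> W then hit i w xs else 1) = 0"
      by (auto simp: hitsq)
    then have "pr W v w xs = 0" unfolding pr_def by (intro prod_zero) auto
    then show ?thesis using False by simp
  qed
  have Epr: "E (pr W v w) \<le> q ^ (D + card {i \<in> W. \<not> Rx i \<subseteq> agree m v w})"
    if "v \<in> V" "w \<in> V" "W \<subseteq> {..<D}" for W v w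
  proof -
    have "{i \<in> W. tgt i v \<noteq> tgt i w} = {i \<in> W. \<not> Rx i \<subseteq> agree m v w}"
      using that same by blast
    then show ?thesis
      using avg_hits_le[OF R(1), of D "\<lambda>i. tgt i v" "\<lambda>i. tgt i w" W q T] that tgt q
      unfolding E_def pr_def hit_def by simp
  qed
  have Efull: "E (pr {} v v) = q ^ D" if "v \<in> V" for v
  proof -
    have "E (pr {} v v) = (\<Prod>i<D. avg R T (\<lambda>ys. of_bool (tgt i v \<in> set ys)))"
      unfolding E_def pr_def hit_def using avg_prod_block[of R D T "\<lambda>i ys. of_bool (tgt i v \<in> set ys)"]
      by simp
    then show ?thesis using avg_hit[OF R(1) tgt] that by (simp add: q)
  qed

  have early: "card {i \<in> {..<D1}. \<not> Rx i \<subseteq> I} = D1 - h I" for I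
  proof -
    have "card ({..<D1} - {i. i < D1 \<and> Rx i \<subseteq> I}) = D1 - h I"
      by (subst card_Diff_subset) (auto simp: h)
    moreover have "{i \<in> {..<D1}. \<not> Rx i \<subseteq> I} = {..<D1} - {i. i < D1 \<and> Rx i \<subseteq> I}" by auto
    ultimately show ?thesis by simp
  qed
  have hle: "h I \<le> D1" for I
    using card_mono[of "{..<D1}" "{i. i < D1 \<and> Rx i \<subseteq> I}"] by (auto simp: h)

  have lower: "E (\<lambda>xs. of_bool (good v xs)) \<ge> q ^ D / 2" if v: "v \<in> V" for v
  proof -
    \<comment> \<open>\<open>Q\<close> lists the possible conflicts of \<open>v\<close>. Their
      expected contribution is subtracted as in a union bound; by \<open>H1\<close> each of the 2^m
      agreement sets accounts for at most q^D / 2^(m+1), so half of the probability q^D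
      survives.\<close>
    define Q where "Q = {w \<in> V. w \<noteq> v \<and> r \<le> card (agree m v w)}"
    have "E (\<lambda>xs. pr {} v v xs - (\<Sum>w\<in>Q. pr {..<D1} v w xs)) \<le> E (\<lambda>xs. of_bool (good v xs))"
      unfolding E_def
    proof (rule avg_mono)
      fix xs
      have nn: "(\<Sum>w\<in>Q. pr {..<D1} v w xs) \<ge> 0" by (intro sum_nonneg) (simp add: pr01)
      show "pr {} v v xs - (\<Sum>w\<in>Q. pr {..<D1} v w xs) \<le> of_bool (good v xs)"
      proof (cases "pr {} v v xs = 1 \<and> \<not> good v xs")
        case True
        then have "\<forall>i<D. tgt i v \<in> set (block T i xs)" by (simp add: pr01)
        with True obtain w where w: "w \<in> Q" "\<forall>i<D1. tgt i w \<in> set (block T i xs)"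
          unfolding good_def Q_def by auto
        then have "pr {..<D1} v w xs = 1"
          using \<open>\<forall>i<D. tgt i v \<in> set (block T i xs)\<close> by (simp add: pr01)
        then have "(\<Sum>w\<in>Q. pr {..<D1} v w xs) \<ge> 1"
          using w(1) finV member_le_sum[of w Q "\<lambda>w. pr {..<D1} v w xs"]
          by (auto simp: pr01 Q_def)
        then show ?thesis using True by simp
      next
        case False
        then show ?thesis using nn by (auto simp: pr01 split: if_splits)
      qed
    qed
    moreover have "E (\<lambda>xs. \<Sum>w\<in>Q. pr {..<D1} v w xs) \<le> q ^ D / 2"
    proof -
      define g where "g I = (if r \<le> card I \<and> card I < m then q ^ (D + (D1 - h I)) else 0)" for I
      have "E (\<lambda>xs. \<Sum>w\<in>Q. pr {..<D1} v w xs) = (\<Sum>w\<in>Q. E (pr {..<D1} v w))"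
        unfolding E_def by (rule avg_sum)
      also have "\<dots> \<le> (\<Sum>w\<in>Q. g (agree m v w))"
      proof (rule sum_mono)
        fix w assume w: "w \<in> Q"
        then have "card (agree m v w) < m"
          using card_agree_less[of v m "{..<b}" w] v by (auto simp: Q_def V_def)
        then show "E (pr {..<D1} v w) \<le> g (agree m v w)"
          using Epr[of v w "{..<D1}"] w v D1 early by (auto simp: g_def Q_def)
      qed
      also have "\<dots> \<le> (\<Sum>w\<in>V. g (agree m v w))"
        using finV q0 by (intro sum_mono2) (auto simp: Q_def g_def)
      also have "\<dots> \<le> (\<Sum>I\<in>Pow {..<m}. real b ^ (m - card I) * g I)"
        unfolding V_def using q0 by (intro sum_agree_le) (auto simp: g_def)
      also have "\<dots> \<le> (\<Sum>I\<in>Pow {..<m}. q ^ D * (1 / 2 ^ (m + 1)))"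
      proof (rule sum_mono)
        fix I assume "I \<in> Pow {..<m}"
        then have "q ^ D * (real b ^ (m - card I) * q ^ (D1 - h I)) \<le> q ^ D * (1 / 2 ^ (m + 1))"
          if "r \<le> card I" "card I < m"
          using H1[of I] that q0 by (intro mult_left_mono) auto
        then show "real b ^ (m - card I) * g I \<le> q ^ D * (1 / 2 ^ (m + 1))"
          using q0 by (auto simp: g_def power_add mult_ac)
      qed
      also have "\<dots> = q ^ D / 2" by (simp add: card_Pow)
      finally show ?thesis .
    qed
    ultimately show ?thesis
      using Efull[OF v] by (simp add: E_def avg_diff)
  qed

  have upper: "(\<Sum>w\<in>V. E (\<lambda>xs. of_bool (good v xs) * of_bool (good w xs))) \<le> q ^ D * (1 + 2 ^ m * C * \<mu>)"
    if v: "v \<in> V" for v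
  proof -
    \<comment> \<open>Two different good tuples cannot agree on \<open>r\<close> or more
      coordinates, so apart from the diagonal only smaller agreement sets count.\<close>
    define g where "g I = (if card I < r then q ^ (D + (D - h I)) else 0)" for I
    have "(\<Sum>w\<in>V. E (\<lambda>xs. of_bool (good v xs) * of_bool (good w xs)))
        \<le> (\<Sum>w\<in>V. (if w = v then q ^ D else 0) + g (agree m v w))"
    proof (rule sum_mono)
      fix w assume w: "w \<in> V"
      consider "w = v" | "w \<noteq> v" "r \<le> card (agree m v w)" | "w \<noteq> v" "card (agree m v w) < r"
        by linarith
      then show "E (\<lambda>xs. of_bool (good v xs) * of_bool (good w xs))
        \<le> (if w = v then q ^ D else 0) + g (agree m v w)"
      proof cases
        case 1
        have "E (\<lambda>xs. of_bool (good v xs) * of_bool (good w xs)) \<le> E (pr {} v v)"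
          unfolding E_def by (rule avg_mono) (auto simp: pr01 good_def)
        then show ?thesis using 1 Efull[OF v] q0 by (auto simp: g_def add_increasing2)
      next
        case 2
        have "of_bool (good v xs) * of_bool (good w xs) = (0::real)" for xs
          using 2 w D1 unfolding good_def by (auto dest: less_le_trans)
        then have "E (\<lambda>xs. of_bool (good v xs) * of_bool (good w xs)) = 0"
          by (simp only: E_def avg_def sum.neutral_const div_0)
        then show ?thesis using 2 q0 by (simp add: g_def)
      next
        case 3
        have "E (\<lambda>xs. of_bool (good v xs) * of_bool (good w xs)) \<le> E (pr {..<D} v w)"
          unfolding E_def by (rule avg_mono) (auto simp: pr01 good_def)
        also have "\<dots> \<le> q ^ (D + card {i \<in> {..<D}. \<not> Rx i \<subseteq> agree m v w})"
          using Epr[OF v w, of "{..<D}"] by simp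
        also have "{i \<in> {..<D}. \<not> Rx i \<subseteq> agree m v w} = {..<D} - {i. i < D1 \<and> Rx i \<subseteq> agree m v w}"
        proof -
          \<comment> \<open>Late targets depend on at least \<open>r\<close> coordinates, so tuples
            agreeing on fewer have different late targets; only early targets can be shared.\<close>
          have "\<not> Rx i \<subseteq> agree m v w" if "i < D" "\<not> i < D1" for i
          proof
            assume "Rx i \<subseteq> agree m v w"
            then have "card (Rx i) \<le> card (agree m v w)"
              using agree_subset[of m v w] by (intro card_mono) (auto intro: finite_subset)
            then show False using late[of i] that 3 by auto
          qed
          then show ?thesis by auto
        qed
        also have "card \<dots> = D - h (agree m v w)"
          using D1 by (subst card_Diff_subset) (auto simp: h)
        finally show ?thesis using 3 by (simp add: g_def)
      qed
    qed
    also have "\<dots> = q ^ D + (\<Sum>w\<in>V. g (agree m v w))"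
      using v finV by (simp add: sum.distrib)
    also have "(\<Sum>w\<in>V. g (agree m v w)) \<le> (\<Sum>I\<in>Pow {..<m}. real b ^ (m - card I) * g I)"
      unfolding V_def using q0 by (intro sum_agree_le) (auto simp: g_def)
    also have "\<dots> \<le> (\<Sum>I\<in>Pow {..<m}. q ^ D * (C * \<mu>))"
    proof (rule sum_mono)
      fix I assume I: "I \<in> Pow {..<m}"
      have nn: "0 \<le> q ^ D * (C * \<mu>)" using q0 C mu by simp
      have "real b ^ (m - card I) * q ^ (D - h I) \<le> C * \<mu>" if "card I < r"
      proof -
        have "card I \<le> m" using I card_mono[of "{..<m}" I] by simp
        \<comment> \<open>The mean \<mu> factors into the weight of the part shared on
          \<open>I\<close>, which by \<open>H2\<close> is at least 1/C, and the weight of its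
          completions, which is therefore at most C times \<mu>.\<close>
        then have "\<mu> = (real b ^ (m - card I) * q ^ (D - h I)) * (real b ^ card I * q ^ h I)"
          using hle[of I] D1 unfolding mu(1)
          by (simp add: mult.commute mult.left_commute flip: power_add)
        then have eq: "C * \<mu> = (real b ^ (m - card I) * q ^ (D - h I)) * (C * (real b ^ card I * q ^ h I))"
          by (simp add: mult_ac)
        show ?thesis
          unfolding eq using mult_left_mono[OF H2[of I], of "real b ^ (m - card I) * q ^ (D - h I)"]
            I that q0 by simp
      qed
      then have "q ^ D * (real b ^ (m - card I) * q ^ (D - h I)) \<le> q ^ D * (C * \<mu>)" if "card I < r"
        using that q0 by (intro mult_left_mono) auto
      then show "real b ^ (m - card I) * g I \<le> q ^ D * (C * \<mu>)"
        using nn by (auto simp: g_def power_add mult_ac)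
    qed
    also have "\<dots> = q ^ D * (2 ^ m * C * \<mu>)" by (simp add: card_Pow)
    finally show ?thesis by (simp add: algebra_simps)
  qed

  define Y where "Y xs = (\<Sum>v\<in>V. of_bool (good v xs) :: real)" for xs
  define P where "P = E (\<lambda>xs. of_bool (\<exists>v\<in>V. good v xs))"
  have EY: "E Y \<ge> \<mu> / 2"
  proof -
    have "E Y = (\<Sum>v\<in>V. E (\<lambda>xs. of_bool (good v xs)))"
      unfolding E_def Y_def by (rule avg_sum)
    also have "\<dots> \<ge> (\<Sum>v\<in>V. q ^ D / 2)" by (intro sum_mono lower)
    finally show ?thesis by (simp add: cardV mu)
  qed
  have EY2: "E (\<lambda>xs. (Y xs)\<^sup>2) \<le> \<mu> * (1 + 2 ^ m * C * \<mu>)"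
  proof -
    have "E (\<lambda>xs. (Y xs)\<^sup>2) = E (\<lambda>xs. \<Sum>v\<in>V. \<Sum>w\<in>V. of_bool (good v xs) * of_bool (good w xs))"
      by (simp add: Y_def power2_eq_square sum_product)
    also have "\<dots> = (\<Sum>v\<in>V. \<Sum>w\<in>V. E (\<lambda>xs. of_bool (good v xs) * of_bool (good w xs)))"
      unfolding E_def avg_sum ..
    also have "\<dots> \<le> (\<Sum>v\<in>V. q ^ D * (1 + 2 ^ m * C * \<mu>))" by (intro sum_mono upper)
    also have "\<dots> = \<mu> * (1 + 2 ^ m * C * \<mu>)" using cardV mu by simp
    finally show ?thesis .
  qed
  \<comment> \<open>The first moment squared is at least \<mu>^2/4; dividing by the bound on the
    second moment gives the claim.\<close>
  have "(E Y)\<^sup>2 \<le> P * E (\<lambda>xs. (Y xs)\<^sup>2)"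
    unfolding P_def E_def by (rule avg_Cauchy_Schwarz) (auto simp: Y_def)
  moreover have "(\<mu> / 2)\<^sup>2 \<le> (E Y)\<^sup>2" using EY mu by (intro power_mono) auto
  moreover have P0: "0 \<le> P" unfolding P_def E_def by (rule avg_nonneg) auto
  moreover have "P * E (\<lambda>xs. (Y xs)\<^sup>2) \<le> P * (\<mu> * (1 + 2 ^ m * C * \<mu>))"
    using EY2 P0 by (rule mult_left_mono)
  ultimately have "(\<mu> / 2)\<^sup>2 \<le> P * (\<mu> * (1 + 2 ^ m * C * \<mu>))" by linarith
  also have "\<dots> = \<mu> * (P * (1 + 2 ^ m * C * \<mu>))" by (rule mult.left_commute)
  also have "(\<mu> / 2)\<^sup>2 = \<mu> * (\<mu> / 4)" by (simp add: power2_eq_square)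
  finally have "\<mu> / 4 \<le> P * (1 + 2 ^ m * C * \<mu>)" using mu(2) by (simp only: mult_le_cancel_left_pos)
  moreover have "0 < 1 + 2 ^ m * C * \<mu>" using C mu by (simp add: add_pos_nonneg)
  ultimately have "\<mu> / (4 * (1 + 2 ^ m * C * \<mu>)) \<le> P" by (simp add: field_simps)
  then show ?thesis unfolding P_def E_def good_def .
qed

subsection \<open>Strategies\<close>

text \<open>The player's own choices are determined by the earlier \<open>r\<close>-sets, so for
  fixed \<open>n\<close> a strategy is encoded as a function of the list of these sets and the
  current one.\<close>

definition admissible :: "nat \<Rightarrow> nat \<Rightarrow> nat \<Rightarrow> (nat set list \<Rightarrow> nat set \<Rightarrow> nat set) \<Rightarrow> bool" where
  "admissible n r s \<sigma> \<longleftrightarrow>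
     (\<forall>xs. \<forall>U\<in>rsets n r. \<sigma> xs U \<subseteq> {1..n} - U \<and> card (\<sigma> xs U) = s - r)"

definition edge_set :: "(nat set list \<Rightarrow> nat set \<Rightarrow> nat set) \<Rightarrow> nat set list \<Rightarrow> nat set set" where
  "edge_set \<sigma> Us = (\<lambda>i. Us ! i \<union> \<sigma> (take i Us) (Us ! i)) ` {..<length Us}"

definition has_clique :: "nat \<Rightarrow> nat \<Rightarrow> nat \<Rightarrow> nat set set \<Rightarrow> bool" where
  "has_clique n k s E \<longleftrightarrow>
     (\<exists>K. K \<subseteq> {1..n} \<and> card K = k \<and> (\<forall>e. e \<subseteq> K \<and> card e = s \<longrightarrow> e \<in> E))"

definition success :: "nat \<Rightarrow> nat \<Rightarrow> nat \<Rightarrow> nat \<Rightarrow> (nat set list \<Rightarrow> nat set \<Rightarrow> nat set) \<Rightarrow> nat \<Rightarrow> real" where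
  "success n r s k \<sigma> t = avg (rsets n r) t (\<lambda>Us. of_bool (has_clique n k s (edge_set \<sigma> Us)))"

lemma finite_rsets [simp]: "finite (rsets n r)"
  unfolding rsets_def by (rule finite_subset[of _ "Pow {1..n}"]) auto

lemma card_rsets: "card (rsets n r) = n choose r"
  using n_subsets[of "{1..n}" r] by (simp add: rsets_def)

lemma rsets_nonempty: "r \<le> n \<Longrightarrow> rsets n r \<noteq> {}"
  using card_rsets[of n r] zero_less_binomial[of r n] by (auto simp del: zero_less_binomial)

lemma has_clique_mono:
  assumes "has_clique n k s E" "E \<subseteq> F"
  shows "has_clique n k s F"
proof -
  obtain K where K: "K \<subseteq> {1..n}" "card K = k" "\<forall>e. e \<subseteq> K \<and> card e = s \<longrightarrow> e \<in> E"
    using assms(1) unfolding has_clique_def by (elim exE conjE)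
  have "\<forall>e. e \<subseteq> K \<and> card e = s \<longrightarrow> e \<in> F"
    using K(3) subsetD[OF assms(2)] by simp
  with K(1,2) show ?thesis
    unfolding has_clique_def by (intro exI[of _ K] conjI)
qed

lemma of_bool_has_clique_mono:
  "E \<subseteq> F \<Longrightarrow> of_bool (has_clique n k s E) \<le> (of_bool (has_clique n k s F) :: real)"
  using has_clique_mono[of n k s E F] by simp

lemma edge_set_cong:
  assumes "\<And>zs. length zs < length ys \<Longrightarrow> \<sigma> zs = \<tau> zs"
  shows "edge_set \<sigma> ys = edge_set \<tau> ys"
  unfolding edge_set_def using assms by (intro image_cong) auto

lemma edge_set_append:
  "edge_set \<sigma> (xs @ ys) = edge_set \<sigma> xs \<union> edge_set (\<lambda>zs. \<sigma> (xs @ zs)) ys"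
proof -
  have "{..<length xs + length ys} = {..<length xs} \<union> (+) (length xs) ` {..<length ys}"
    by (subst ivl_disj_un_one(2)[of "length xs" "length xs + length ys", symmetric])
       (simp_all add: lessThan_atLeast0 add.commute)
  then show ?thesis
    unfolding edge_set_def length_append by (simp only: image_Un image_image) (simp add: nth_append)
qed

lemma edge_set_snoc: "edge_set \<sigma> (xs @ [U]) = insert (U \<union> \<sigma> xs U) (edge_set \<sigma> xs)"
  by (simp add: edge_set_append) (simp add: edge_set_def lessThan_Suc)

lemma edge_set_subset:
  assumes "admissible n r s \<sigma>" "Us \<in> words (rsets n r) t" "r \<le> s"
  shows "edge_set \<sigma> Us \<subseteq> {e. e \<subseteq> {1..n} \<and> card e = s}"
proof safe
  fix e assume "e \<in> edge_set \<sigma> Us"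
  then obtain i where i: "i < length Us" "e = Us ! i \<union> \<sigma> (take i Us) (Us ! i)"
    by (auto simp: edge_set_def)
  then have U: "Us ! i \<in> rsets n r" using assms(2) by (auto simp: words_def)
  with assms(1) have V: "\<sigma> (take i Us) (Us ! i) \<subseteq> {1..n} - Us ! i"
      "card (\<sigma> (take i Us) (Us ! i)) = s - r"
    by (auto simp: admissible_def)
  have fin: "finite (Us ! i)" "finite (\<sigma> (take i Us) (Us ! i))"
    using U V finite_subset[of _ "{1..n}"] unfolding rsets_def by blast+
  show "card e = s"
    unfolding i(2) using U V fin assms(3)
    by (subst card_Un_disjoint) (auto simp: rsets_def)
  show "x \<in> {1..n}" if "x \<in> e" for x
    using that U V unfolding i(2) rsets_def by auto
qed

lemma map_fst_history [simp]: "map fst (history S n Us) = Us"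
  by (induction Us rule: rev_induct) (simp_all add: history_def)

text \<open>Link from the simplified encoding back to the original one: the strategy reads only the
  first components of its history.\<close>

lemma set_edges_of:
  "set (edges_of (\<lambda>n h U. \<sigma> n (map fst h) U) n Us) = edge_set (\<sigma> n) Us" (is "set (edges_of ?S n Us) = _")
proof (induction Us rule: rev_induct)
  case Nil
  then show ?case by (simp add: edges_of_def history_def edge_set_def)
next
  case (snoc U Us)
  have "history ?S n (Us @ [U]) = history ?S n Us @ [(U, \<sigma> n Us U)]"
    using map_fst_history[of ?S n Us] by (simp add: history_def)
  then show ?case using snoc by (simp add: edges_of_def edge_set_snoc)
qed

lemma clique_prob_eq_success:
  "clique_prob r s k (\<lambda>n h U. \<sigma> n (map fst h) U) n t = success n r s k (\<sigma> n) t"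
proof -
  have eq: "contains_clique n k s (edges_of (\<lambda>n h U. \<sigma> n (map fst h) U) n Us)
      \<longleftrightarrow> has_clique n k s (edge_set (\<sigma> n) Us)" for Us
    by (simp only: contains_clique_def has_clique_def set_edges_of)
  have "{Us. length Us = t \<and> set Us \<subseteq> rsets n r \<and>
          contains_clique n k s (edges_of (\<lambda>n h U. \<sigma> n (map fst h) U) n Us)}
      = words (rsets n r) t \<inter> {Us. has_clique n k s (edge_set (\<sigma> n) Us)}"
    unfolding words_def eq by auto
  moreover have "{Us. length Us = t \<and> set Us \<subseteq> rsets n r} = words (rsets n r) t"
    by (auto simp: words_def)
  ultimately show ?thesis
    by (simp add: clique_prob_def success_def avg_def card_words of_bool_def sum.If_cases)
qed

lemma success_le_1:
  assumes "r \<le> n"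
  shows "success n r s k \<sigma> t \<le> 1"
proof -
  have "success n r s k \<sigma> t \<le> avg (rsets n r) t (\<lambda>_. 1)"
    unfolding success_def by (rule avg_mono) auto
  then show ?thesis using assms by (simp add: avg_const rsets_nonempty)
qed

text \<open>Edges are never removed: condition on the first \<open>t\<close> draws and ignore the
  rest.\<close>

lemma success_mono:
  assumes "r \<le> n" "t \<le> t'"
  shows "success n r s k \<sigma> t \<le> success n r s k \<sigma> t'"
proof -
  have t': "t' = t + (t' - t)" using assms by simp
  have "success n r s k \<sigma> t = avg (rsets n r) t (\<lambda>xs. avg (rsets n r) (t' - t)
      (\<lambda>ys. of_bool (has_clique n k s (edge_set \<sigma> xs))))"
    using assms by (simp add: avg_const rsets_nonempty success_def)
  also have "\<dots> \<le> success n r s k \<sigma> (t + (t' - t))"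
    unfolding success_def avg_append
    by (intro avg_mono of_bool_has_clique_mono) (simp add: edge_set_append)
  finally show ?thesis using t' by simp
qed

lemma ex_admissible:
  assumes "r \<le> s" "s \<le> n"
  shows "\<exists>\<sigma>. admissible n r s \<sigma>"
proof -
  have "\<exists>V. V \<subseteq> {1..n} - U \<and> card V = s - r" if "U \<in> rsets n r" for U
  proof -
    have "s - r \<le> card ({1..n} - U)"
      using that assms by (subst card_Diff_subset) (auto simp: rsets_def intro: finite_subset[OF _ finite_atLeastAtMost])
    then show ?thesis by (meson obtain_subset_with_card_n)
  qed
  then have "admissible n r s (\<lambda>xs U. SOME V. V \<subseteq> {1..n} - U \<and> card V = s - r)"
    unfolding admissible_def by (metis (mono_tags, lifting) someI_ex)
  then show ?thesis by blast
qed

text \<open>Two-stage play: after \<open>t1\<close> steps a clique on \<open>l\<close> vertices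
  present by then is fixed as core, and a strategy tailored to this core takes over. The stages use
  independent draws, so the bounds multiply.\<close>

lemma success_compose:
  assumes rs: "r \<le> s" "s \<le> n"
    and one: "admissible n r s \<sigma>" "c1 \<le> success n r s l \<sigma> t1"
    and two: "\<And>L. L \<subseteq> {1..n} \<Longrightarrow> card L = l \<Longrightarrow> \<exists>\<tau>. admissible n r s \<tau> \<and>
      c2 \<le> avg (rsets n r) t2 (\<lambda>Us. of_bool (has_clique n k s ({e. e \<subseteq> L \<and> card e = s} \<union> edge_set \<tau> Us)))"
    and c2: "0 \<le> c2"
  shows "\<exists>\<rho>. admissible n r s \<rho> \<and> c1 * c2 \<le> success n r s k \<rho> (t1 + t2)"
proof -
  define core where "core xs = (SOME L. L \<subseteq> {1..n} \<and> card L = l \<and>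
    (\<forall>e. e \<subseteq> L \<and> card e = s \<longrightarrow> e \<in> edge_set \<sigma> xs))" for xs
  have coreI: "core xs \<subseteq> {1..n} \<and> card (core xs) = l \<and>
      (\<forall>e. e \<subseteq> core xs \<and> card e = s \<longrightarrow> e \<in> edge_set \<sigma> xs)"
    if "has_clique n l s (edge_set \<sigma> xs)" for xs
    using that unfolding has_clique_def core_def by (rule someI_ex)
  define good where "good L \<tau> \<longleftrightarrow> admissible n r s \<tau> \<and>
      c2 \<le> avg (rsets n r) t2 (\<lambda>Us. of_bool (has_clique n k s ({e. e \<subseteq> L \<and> card e = s} \<union> edge_set \<tau> Us)))" for L \<tau>
  define \<tau> where "\<tau> L = (SOME \<tau>. good L \<tau>)" for L
  have \<tau>: "good L (\<tau> L)" if "L \<subseteq> {1..n}" "card L = l" for L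
    unfolding \<tau>_def using two[OF that] unfolding good_def by (rule someI_ex)
  define \<rho> where "\<rho> xs = (if t1 \<le> length xs \<and> core (take t1 xs) \<subseteq> {1..n} \<and> card (core (take t1 xs)) = l
      then \<tau> (core (take t1 xs)) (drop t1 xs) else \<sigma> xs)" for xs
  have "admissible n r s \<rho>"
    unfolding admissible_def
  proof (intro allI)
    fix xs
    have "\<exists>\<sigma>' ys. \<rho> xs = \<sigma>' ys \<and> admissible n r s \<sigma>'"
      using \<tau>[of "core (take t1 xs)"] one(1) unfolding \<rho>_def good_def
      by (cases "t1 \<le> length xs \<and> core (take t1 xs) \<subseteq> {1..n} \<and> card (core (take t1 xs)) = l") auto
    then show "\<forall>U\<in>rsets n r. \<rho> xs U \<subseteq> {1..n} - U \<and> card (\<rho> xs U) = s - r"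
      unfolding admissible_def by (elim exE conjE) simp
  qed
  moreover have "c1 * c2 \<le> success n r s k \<rho> (t1 + t2)"
  proof -
    have "c1 * c2 \<le> success n r s l \<sigma> t1 * c2" using one c2 by (intro mult_right_mono)
    also have "\<dots> = avg (rsets n r) t1 (\<lambda>xs. of_bool (has_clique n l s (edge_set \<sigma> xs)) * c2)"
      by (simp add: success_def avg_cmult_right)
    also have "\<dots> \<le> success n r s k \<rho> (t1 + t2)"
      unfolding success_def avg_append
    proof (rule avg_mono)
      fix xs assume xs: "xs \<in> words (rsets n r) t1"
      show "of_bool (has_clique n l s (edge_set \<sigma> xs)) * c2
        \<le> avg (rsets n r) t2 (\<lambda>ys. of_bool (has_clique n k s (edge_set \<rho> (xs @ ys))))"
      proof (cases "has_clique n l s (edge_set \<sigma> xs)")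
        case True
        then have core: "core xs \<subseteq> {1..n}" "card (core xs) = l"
            "{e. e \<subseteq> core xs \<and> card e = s} \<subseteq> edge_set \<sigma> xs"
          using coreI[of xs] by simp_all auto
        have len: "length xs = t1" using xs by (simp add: words_def)
        have eq: "edge_set \<rho> (xs @ ys) = edge_set \<sigma> xs \<union> edge_set (\<tau> (core xs)) ys" for ys
        proof -
          have "edge_set \<rho> xs = edge_set \<sigma> xs"
            using len by (intro edge_set_cong) (simp add: \<rho>_def)
          then show ?thesis using len core by (simp add: edge_set_append \<rho>_def)
        qed
        have "c2 \<le> avg (rsets n r) t2 (\<lambda>ys. of_bool (has_clique n k s
            ({e. e \<subseteq> core xs \<and> card e = s} \<union> edge_set (\<tau> (core xs)) ys)))"
          using \<tau>[OF core(1,2)] unfolding good_def by (rule conjunct2)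
        also have "\<dots> \<le> avg (rsets n r) t2 (\<lambda>ys. of_bool (has_clique n k s (edge_set \<rho> (xs @ ys))))"
          unfolding eq using core(3) by (intro avg_mono of_bool_has_clique_mono) auto
        finally show ?thesis using True by simp
      next
        case False
        then show ?thesis by (auto intro: avg_nonneg)
      qed
    qed
    finally show ?thesis .
  qed
  ultimately show ?thesis by blast
qed

section \<open>Constant success probability within order n^x steps\<close>

definition achievable :: "nat \<Rightarrow> nat \<Rightarrow> nat \<Rightarrow> real \<Rightarrow> bool" where
  "achievable r s k x \<longleftrightarrow> (\<exists>c>0. \<exists>C N. \<forall>n\<ge>N. \<exists>t \<sigma>. admissible n r s \<sigma> \<and>
     real t \<le> C * real n powr x \<and> c \<le> success n r s k \<sigma> t)"

lemma achievableI:
  assumes "c > 0"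
    and "\<And>n. n \<ge> N \<Longrightarrow> \<exists>t \<sigma>. admissible n r s \<sigma> \<and>
      real t \<le> C * real n powr x \<and> c \<le> success n r s k \<sigma> t"
  shows "achievable r s k x"
  unfolding achievable_def
  by (rule exI[of _ c], rule conjI, rule assms(1), rule exI[of _ C], rule exI[of _ N])
     (intro allI impI assms(2))

lemma achievable_mono:
  assumes "achievable r s k x" "x \<le> y"
  shows "achievable r s k y"
proof -
  obtain c C N where c: "c > 0" and *: "\<And>n. n \<ge> N \<Longrightarrow> \<exists>t \<sigma>. admissible n r s \<sigma> \<and>
     real t \<le> C * real n powr x \<and> c \<le> success n r s k \<sigma> t"
    using assms(1) unfolding achievable_def by metis
  have "\<exists>t \<sigma>. admissible n r s \<sigma> \<and> real t \<le> \<bar>C\<bar> * real n powr y \<and> c \<le> success n r s k \<sigma> t"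
    if "n \<ge> max N 1" for n
  proof -
    from that have "n \<ge> N" by simp
    from *[OF this] obtain t \<sigma> where t: "admissible n r s \<sigma>" "real t \<le> C * real n powr x" "c \<le> success n r s k \<sigma> t"
      by blast
    note t(2)
    also have "C * real n powr x \<le> \<bar>C\<bar> * real n powr y"
      using that assms(2) by (intro mult_mono powr_mono) auto
    finally show ?thesis using t by blast
  qed
  then show ?thesis by (rule achievableI[OF c])
qed

text \<open>Fewer than \<open>s\<close> vertices contain no \<open>s\<close>-set, so the clique
  condition is vacuous and zero steps suffice for every exponent.\<close>

lemma achievable_small:
  assumes "r < s" "k < s"
  shows "achievable r s k x"
proof -
  have "\<exists>t \<sigma>. admissible n r s \<sigma> \<and> real t \<le> 1 * real n powr x \<and> 1 \<le> success n r s k \<sigma> t"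
    if n: "n \<ge> s" for n
  proof -
    obtain \<sigma> where \<sigma>: "admissible n r s \<sigma>" using ex_admissible[of r s n] n assms by fastforce
    have "card {1..k} = k" "{1..k} \<subseteq> {1..n}" using n assms by auto
    moreover have "card e < s" if "e \<subseteq> {1..k}" for e
      using card_mono[of "{1..k}" e] that assms by auto
    ultimately have "has_clique n k s (edge_set \<sigma> [])"
      unfolding has_clique_def by (intro exI[of _ "{1..k}"]) auto
    then have "success n r s k \<sigma> 0 = 1" by (simp add: success_def avg_def)
    then show ?thesis using \<sigma> by (intro exI[of _ 0] exI[of _ \<sigma>]) simp
  qed
  then show ?thesis by (rule achievableI[OF zero_less_one])
qed

text \<open>A single edge is itself a clique on \<open>s\<close> vertices, so the first step already
  succeeds.\<close>

lemma success_single_edge: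
  assumes "r \<le> s" "s \<le> n" "admissible n r s \<sigma>" "t \<ge> 1"
  shows "success n r s s \<sigma> t = 1"
proof -
  have "success n r s s \<sigma> t = avg (rsets n r) t (\<lambda>_. 1)"
    unfolding success_def
  proof (rule avg_cong)
    fix Us assume Us: "Us \<in> words (rsets n r) t"
    define e where "e = Us ! 0 \<union> \<sigma> (take 0 Us) (Us ! 0)"
    have e: "e \<in> edge_set \<sigma> Us"
      unfolding e_def edge_set_def using Us assms(4) by (intro imageI) (auto simp: words_def)
    then have "e \<subseteq> {1..n}" "card e = s"
      using edge_set_subset[OF assms(3) Us assms(1)] by auto
    moreover have "e' = e" if "e' \<subseteq> e" "card e' = s" for e'
      using that \<open>card e = s\<close> \<open>e \<subseteq> {1..n}\<close> by (intro card_subset_eq) (auto intro: finite_subset[OF _ finite_atLeastAtMost])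
    ultimately have "has_clique n s s (edge_set \<sigma> Us)"
      using e unfolding has_clique_def by (intro exI[of _ e]) auto
    then show "of_bool (has_clique n s s (edge_set \<sigma> Us)) = (1::real)" by simp
  qed
  then show ?thesis using assms by (simp add: avg_const rsets_nonempty)
qed

lemma achievable_single_edge:
  assumes "r < s" "0 \<le> x"
  shows "achievable r s s x"
proof -
  have "\<exists>t \<sigma>. admissible n r s \<sigma> \<and> real t \<le> 1 * real n powr x \<and> 1 \<le> success n r s s \<sigma> t"
    if n: "n \<ge> s" for n
  proof -
    obtain \<sigma> where "admissible n r s \<sigma>" using ex_admissible[of r s n] n assms by fastforce
    then show ?thesis
      using success_single_edge[of r s n \<sigma> 1] n assms
      by (intro exI[of _ 1] exI[of _ \<sigma>]) (auto simp: ge_one_powr_ge_zero)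
  qed
  then show ?thesis by (rule achievableI[OF zero_less_one])
qed

section \<open>Amplification by independent restarts\<close>

definition restart :: "nat \<Rightarrow> (nat set list \<Rightarrow> nat set \<Rightarrow> nat set) \<Rightarrow> nat set list \<Rightarrow> nat set \<Rightarrow> nat set" where
  "restart t \<sigma> xs = \<sigma> (drop (length xs div t * t) xs)"

text \<open>Rounds of \<open>t\<close> steps use independent draws and each starts
  \<open>\<sigma>\<close> afresh, so the bounds on the failure probability multiply. Cliques using
  edges of several rounds are simply not counted.\<close>

lemma restart_success:
  assumes "r \<le> n" "t > 0" "c \<le> success n r s k \<sigma> t"
  shows "1 - success n r s k (restart t \<sigma>) (e * t) \<le> (1 - c) ^ e"
proof (induction e)
  case 0
  then show ?case by (simp add: success_def avg_def)
next
  case (Suc e)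
  let ?R = "rsets n r"
  let ?f = "\<lambda>\<tau> xs. 1 - of_bool (has_clique n k s (edge_set \<tau> xs)) :: real"
  have fail: "1 - success n r s k \<tau> u = avg ?R u (?f \<tau>)" for \<tau> u
    using assms by (simp add: success_def avg_diff avg_const rsets_nonempty)
  have "1 - success n r s k (restart t \<sigma>) (Suc e * t)
      = avg ?R (e * t) (\<lambda>xs. avg ?R t (\<lambda>ys. ?f (restart t \<sigma>) (xs @ ys)))"
    unfolding fail by (simp only: mult_Suc add.commute[of t] avg_append)
  also have "\<dots> \<le> avg ?R (e * t) (\<lambda>xs. avg ?R t (\<lambda>ys. ?f (restart t \<sigma>) xs * ?f \<sigma> ys))"
  proof (intro avg_mono)
    fix xs ys assume xs: "xs \<in> words ?R (e * t)" and ys: "ys \<in> words ?R t"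
    have "edge_set (\<lambda>zs. restart t \<sigma> (xs @ zs)) ys = edge_set \<sigma> ys"
    proof (rule edge_set_cong)
      fix zs :: "nat set list" assume "length zs < length ys"
      then have "length zs < t" "length xs = e * t" using xs ys by (auto simp: words_def)
      \<comment> \<open>Inside the last round the quotient stays \<open>e\<close>, so exactly the
        \<open>e\<close> finished rounds are dropped.\<close>
      then have "(length xs + length zs) div t = e"
        using assms(2) by (simp add: add.commute)
      then show "restart t \<sigma> (xs @ zs) = \<sigma> zs"
        using \<open>length xs = e * t\<close> by (simp add: restart_def)
    qed
    then have "edge_set (restart t \<sigma>) (xs @ ys) = edge_set (restart t \<sigma>) xs \<union> edge_set \<sigma> ys"
      by (simp add: edge_set_append)
    then show "?f (restart t \<sigma>) (xs @ ys) \<le> ?f (restart t \<sigma>) xs * ?f \<sigma> ys"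
      using has_clique_mono[of n k s "edge_set (restart t \<sigma>) xs" "edge_set (restart t \<sigma>) (xs @ ys)"]
        has_clique_mono[of n k s "edge_set \<sigma> ys" "edge_set (restart t \<sigma>) (xs @ ys)"]
      by simp
  qed
  also have "\<dots> = (1 - success n r s k (restart t \<sigma>) (e * t)) * (1 - success n r s k \<sigma> t)"
    unfolding fail avg_cmult avg_cmult_right ..
  also have "\<dots> \<le> (1 - c) ^ e * (1 - c)"
    using Suc.IH assms success_le_1[OF assms(1), of s k \<sigma> t] by (intro mult_mono) auto
  finally show ?case by (simp add: mult.commute)
qed

lemma admissible_restart: "admissible n r s \<sigma> \<Longrightarrow> admissible n r s (restart t \<sigma>)"
  by (simp add: admissible_def restart_def)

text \<open>The restarted strategy does not depend on \<open>t\<close>. If \<open>t\<close> grows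
  faster than n^x, the number \<open>e\<close> of complete rounds tends to infinity, and the failure
  probability, at most (1 - c)^e, tends to 0.\<close>

lemma achievable_imp_strategy:
  assumes ach: "achievable r s k x" and x: "0 \<le> x" and rs: "r < s"
  shows "\<exists>S. valid_strategy r s S \<and> (\<forall>t :: nat \<Rightarrow> nat.
       (\<lambda>n. real n powr x) \<in> o(\<lambda>n. real (t n)) \<longrightarrow>
       ((\<lambda>n. clique_prob r s k S n (t n)) \<longlongrightarrow> 1) at_top)"
proof -
  obtain c C N where c: "c > 0" and *: "\<And>n. n \<ge> N \<Longrightarrow> \<exists>t \<sigma>. admissible n r s \<sigma> \<and>
     real t \<le> C * real n powr x \<and> c \<le> success n r s k \<sigma> t"
    using ach unfolding achievable_def by metis
  then obtain u \<sigma> where us: "\<And>n. n \<ge> N \<Longrightarrow> admissible n r s (\<sigma> n) \<and>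
     real (u n) \<le> C * real n powr x \<and> c \<le> success n r s k (\<sigma> n) (u n)"
    by metis
  obtain \<delta> where \<delta>: "\<And>n. s \<le> n \<Longrightarrow> admissible n r s (\<delta> n)"
    using ex_admissible[of r s] less_imp_le[OF rs] by metis
  \<comment> \<open>\<open>Suc (u n)\<close> keeps the round length positive even if
    \<open>u n\<close> is 0. Below the threshold \<open>N\<close> a default strategy is
    enough.\<close>
  define \<rho> where "\<rho> n = (if n \<ge> N then restart (Suc (u n)) (\<sigma> n) else \<delta> n)" for n
  define S :: strategy where "S = (\<lambda>n h U. \<rho> n (map fst h) U)"
  have "admissible n r s (\<rho> n)" if "s \<le> n" for n
    using us \<delta> that by (auto simp: \<rho>_def admissible_restart)
  then have "valid_strategy r s S"
    unfolding valid_strategy_def S_def admissible_def by blast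
  moreover have "((\<lambda>n. clique_prob r s k S n (t n)) \<longlongrightarrow> 1) at_top"
    if t: "(\<lambda>n. real n powr x) \<in> o(\<lambda>n. real (t n))" for t :: "nat \<Rightarrow> nat"
  proof -
    define e where "e n = t n div Suc (u n)" for n
    \<comment> \<open>A round has at most \<open>B\<close> times n^x steps: n^x >= 1 absorbs the
      extra step in \<open>Suc (u n)\<close>.\<close>
    define B where "B = \<bar>C\<bar> + 1"
    have lower: "1 - (1 - c) ^ e n \<le> clique_prob r s k S n (t n)" if "n \<ge> max N r" for n
    proof -
      have n: "n \<ge> N" "r \<le> n" using that by auto
      have "c \<le> success n r s k (\<sigma> n) (Suc (u n))"
        using us[OF n(1)] success_mono[OF n(2), of "u n" "Suc (u n)" s k "\<sigma> n"] by auto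
      then have "1 - (1 - c) ^ e n \<le> success n r s k (\<rho> n) (e n * Suc (u n))"
        using restart_success[OF n(2), of "Suc (u n)" c s k "\<sigma> n" "e n"] n
        by (simp add: \<rho>_def)
      also have "\<dots> \<le> success n r s k (\<rho> n) (t n)"
        using div_times_less_eq_dividend[of "t n" "Suc (u n)"]
        by (intro success_mono n) (simp only: e_def)
      finally show ?thesis unfolding S_def clique_prob_eq_success .
    qed
    have "filterlim e at_top at_top"
      unfolding filterlim_at_top
    proof
      fix Z :: nat
      \<comment> \<open>The constant in the little-o is chosen so that \<open>Z + 1\<close> rounds
        fit into \<open>t n\<close> steps.\<close>
      have "eventually (\<lambda>n. norm (real n powr x) \<le> 1 / (B * (real Z + 1)) * norm (real (t n))) at_top"
        by (rule landau_o.smallD[OF t]) (simp add: B_def add_pos_nonneg)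
      then show "eventually (\<lambda>n. Z \<le> e n) at_top"
        using eventually_ge_at_top[of "max N 1"]
      proof eventually_elim
        case (elim n)
        have pos: "0 < B * (real Z + 1)" by (simp add: B_def add_pos_nonneg)
        have "real (u n) + 1 \<le> \<bar>C\<bar> * real n powr x + 1 * real n powr x"
        proof (intro add_mono)
          show "real (u n) \<le> \<bar>C\<bar> * real n powr x"
            using us[of n] elim by (auto intro: order_trans[OF _ mult_right_mono[of C "\<bar>C\<bar>"]])
          show "1 \<le> 1 * real n powr x" using elim x by (simp add: ge_one_powr_ge_zero)
        qed
        also have "\<dots> = B * real n powr x" by (simp add: B_def algebra_simps)
        finally have "(real (u n) + 1) * (real Z + 1) \<le> (B * real n powr x) * (real Z + 1)"
          by (intro mult_right_mono) auto
        also have "\<dots> \<le> real (t n)"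
          using elim(1) pos by (simp add: field_simps)
        finally have "real (Suc (u n) * (Z + 1)) \<le> real (t n)" by (simp add: algebra_simps)
        then have "Suc (u n) * (Z + 1) \<le> t n" by (simp only: of_nat_le_iff)
        then have "Z * Suc (u n) \<le> t n" by (simp add: algebra_simps)
        then show ?case by (simp add: e_def less_eq_div_iff_mult_less_eq del: mult_Suc_right)
      qed
    qed
    moreover have "\<bar>1 - c\<bar> < 1"
    proof -
      have "c \<le> 1"
        using us[of "max N r"] success_le_1[of r "max N r" s k] by (meson max.cobounded1 max.cobounded2 order_trans)
      then show ?thesis using c by simp
    qed
    ultimately have "(\<lambda>n. (1 - c) ^ e n) \<longlonglongrightarrow> 0"
      by (intro filterlim_compose[OF LIMSEQ_power_zero]) auto
    then have "(\<lambda>n. 1 - (1 - c) ^ e n) \<longlonglongrightarrow> 1 - 0" by (intro tendsto_diff tendsto_const)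
    then have lim: "(\<lambda>n. 1 - (1 - c) ^ e n) \<longlonglongrightarrow> 1" by simp
    show ?thesis
    proof (rule tendsto_sandwich[OF _ _ lim tendsto_const])
      show "eventually (\<lambda>n. 1 - (1 - c) ^ e n \<le> clique_prob r s k S n (t n)) at_top"
        using eventually_ge_at_top[of "max N r"] by eventually_elim (rule lower)
      show "eventually (\<lambda>n. clique_prob r s k S n (t n) \<le> 1) at_top"
        using eventually_ge_at_top[of r]
        by eventually_elim (simp add: S_def clique_prob_eq_success success_le_1)
    qed
  qed
  ultimately show ?thesis by blast
qed

text \<open>Eventually the integer \<open>t n\<close> is positive, hence at least 1, and one step
  suffices. The exponent may be negative here.\<close>

lemma single_edge_strategy:
  assumes "r < s"
  shows "\<exists>S. valid_strategy r s S \<and> (\<forall>t :: nat \<Rightarrow> nat.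
       (\<lambda>n. real n powr x) \<in> o(\<lambda>n. real (t n)) \<longrightarrow>
       ((\<lambda>n. clique_prob r s s S n (t n)) \<longlongrightarrow> 1) at_top)"
proof -
  obtain \<delta> where \<delta>: "\<And>n. s \<le> n \<Longrightarrow> admissible n r s (\<delta> n)"
    using ex_admissible[of r s] less_imp_le[OF assms] by metis
  define S :: strategy where "S = (\<lambda>n h U. \<delta> n (map fst h) U)"
  have "valid_strategy r s S"
    using \<delta> unfolding valid_strategy_def S_def admissible_def by blast
  moreover have "((\<lambda>n. clique_prob r s s S n (t n)) \<longlongrightarrow> 1) at_top"
    if t: "(\<lambda>n. real n powr x) \<in> o(\<lambda>n. real (t n))" for t :: "nat \<Rightarrow> nat"
  proof (rule tendsto_eventually)
    have "eventually (\<lambda>n. norm (real n powr x) \<le> 1 * norm (real (t n))) at_top"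
      by (rule landau_o.smallD[OF t]) simp
    then show "eventually (\<lambda>n. clique_prob r s s S n (t n) = 1) at_top"
      using eventually_ge_at_top[of s]
    proof eventually_elim
      case (elim n)
      have "0 < real n powr x" using elim assms by simp
      moreover have "real n powr x \<le> real (t n)" using elim by simp
      ultimately have "0 < real (t n)" by (rule less_le_trans)
      then have "t n \<ge> 1" by simp
      then show ?case
        using elim assms \<delta> by (simp add: S_def clique_prob_eq_success success_single_edge)
    qed
  qed
  ultimately show ?thesis by blast
qed

subsection \<open>Extending a core clique\<close>

text \<open>\<open>A\<close> is determined by its traces on \<open>I\<close> and \<open>C\<close>,
  which can be chosen independently.\<close>

lemma card_split_subsets:
  assumes "finite I" "finite C" "I \<inter> C = {}" "j \<le> s"
  shows "card {A. A \<subseteq> I \<union> C \<and> card A = s \<and> card (A \<inter> I) = j}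
    = (card I choose j) * (card C choose (s - j))"
proof -
  have un: "card A = card (A \<inter> I) + card (A \<inter> C)" if "A \<subseteq> I \<union> C" for A
  proof -
    have "A = (A \<inter> I) \<union> (A \<inter> C)" using that by auto
    then have "card A = card ((A \<inter> I) \<union> (A \<inter> C))" by simp
    also have "\<dots> = card (A \<inter> I) + card (A \<inter> C)"
      using assms by (intro card_Un_disjoint) auto
    finally show ?thesis .
  qed
  have "bij_betw (\<lambda>A. (A \<inter> I, A \<inter> C)) {A. A \<subseteq> I \<union> C \<and> card A = s \<and> card (A \<inter> I) = j}
      ({J. J \<subseteq> I \<and> card J = j} \<times> {S. S \<subseteq> C \<and> card S = s - j})"
  proof (rule bij_betwI[where g = "\<lambda>(J, S). J \<union> S"], goal_cases)
    case 1
    show ?case using un by auto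
  next
    case 2
    have *: "(J \<union> S) \<inter> I = J" "(J \<union> S) \<inter> C = S" if "J \<subseteq> I" "S \<subseteq> C" for J S
      using that assms(3) by auto
    have "(J \<union> S) \<inter> I = J" "card (J \<union> S) = s"
      if "J \<subseteq> I" "S \<subseteq> C" "card J = j" "card S = s - j" for J S
    proof -
      show "(J \<union> S) \<inter> I = J" using that * by auto
      have "J \<union> S \<subseteq> I \<union> C" using that by auto
      from un[OF this] show "card (J \<union> S) = s" using that * assms(4) by simp
    qed
    then show ?case by auto
  next
    case (3 A)
    then show ?case by auto
  next
    case (4 p)
    then show ?case using assms(3) by (cases p) auto
  qed
  from bij_betw_same_card[OF this] show ?thesis
    using n_subsets[OF assms(1)] n_subsets[OF assms(2)] by (simp add: card_cartesian_product)
qed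

text \<open>With \<open>l\<close> core vertices this counts the edges having between 1 and
  \<open>r\<close> new vertices, all from a given set of \<open>i\<close> new ones. The sum starts
  at 1 because edges without new vertices already lie in the core.\<close>

definition early_count :: "nat \<Rightarrow> nat \<Rightarrow> nat \<Rightarrow> nat \<Rightarrow> nat" where
  "early_count l r s i = (\<Sum>j=1..r. (l choose (s - j)) * (i choose j))"

lemma card_early:
  assumes "finite I" "finite C" "I \<inter> C = {}" "r \<le> s"
  shows "card {A. A \<subseteq> I \<union> C \<and> card A = s \<and> A \<inter> I \<noteq> {} \<and> card (A \<inter> I) \<le> r}
    = early_count (card C) r s (card I)"
proof -
  have ne: "A \<inter> I \<noteq> {} \<longleftrightarrow> 1 \<le> card (A \<inter> I)" for A
    using assms(1) by (simp add: Suc_le_eq card_gt_0_iff)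
  have "{A. A \<subseteq> I \<union> C \<and> card A = s \<and> A \<inter> I \<noteq> {} \<and> card (A \<inter> I) \<le> r}
      = (\<Union>j\<in>{1..r}. {A. A \<subseteq> I \<union> C \<and> card A = s \<and> card (A \<inter> I) = j})"
    unfolding ne by auto
  also have "card \<dots> = (\<Sum>j=1..r. card {A. A \<subseteq> I \<union> C \<and> card A = s \<and> card (A \<inter> I) = j})"
  proof (intro card_UN_disjoint ballI impI)
    show "finite {A. A \<subseteq> I \<union> C \<and> card A = s \<and> card (A \<inter> I) = j}" for j
      using assms by (rule_tac finite_subset[of _ "Pow (I \<union> C)"]) auto
  qed auto
  also have "\<dots> = early_count (card C) r s (card I)"
    unfolding early_count_def using assms
    by (intro sum.cong) (auto simp: card_split_subsets mult.commute)
  finally show ?thesis .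
qed

text \<open>Each missing edge has its own block of \<open>T\<close> steps; early edges have at most
  \<open>r\<close> new vertices, late ones more. Each new vertex ranges over its own class of
  \<open>b\<close> vertices. \<open>second_moment\<close> yields a tuple whose targets are all hit
  and which has no conflict, and the strategy below completes the clique of any such tuple.\<close>

lemma extend_core:
  fixes n l m k b r s T D :: nat and q C \<mu> :: real and L :: "nat set"
  assumes rs: "r < s" "s \<le> n" and k: "k = l + m" and n: "l + m * b \<le> n"
    and L: "L \<subseteq> {1..n}" "card L = l"
    and T: "0 < T" "T \<le> card (rsets n r)"
    and D: "D = (k choose s) - (l choose s)"
    and q: "q = hit_prob (card (rsets n r)) T"
    and H1: "\<And>i. r \<le> i \<Longrightarrow> i < m \<Longrightarrow>
      real b ^ (m - i) * q ^ (early_count l r s m - early_count l r s i) \<le> 1 / 2 ^ (m + 1)"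
    and H2: "\<And>i. i \<le> m \<Longrightarrow> 1 \<le> C * (real b ^ i * q ^ early_count l r s i)"
    and C: "0 \<le> C"
    and mu: "\<mu> = real b ^ m * q ^ D" "0 < \<mu>"
  shows "\<exists>\<sigma>. admissible n r s \<sigma> \<and> \<mu> / (4 * (1 + 2 ^ m * C * \<mu>)) \<le> avg (rsets n r) (D * T)
    (\<lambda>Us. of_bool (has_clique n k s ({e. e \<subseteq> L \<and> card e = s} \<union> edge_set \<sigma> Us)))"
proof -
  \<comment> \<open>Vertices of the clique are labelled by \<open>{..<m}\<close> (new) and \<open>{m..<k}\<close> (in \<open>L\<close>); a type is a missing edge.\<close>
  define types where "types = {A. A \<subseteq> {..<k} \<and> card A = s \<and> A \<inter> {..<m} \<noteq> {}}"
  define P1 where "P1 = {A \<in> types. card (A \<inter> {..<m}) \<le> r}"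
  define P2 where "P2 = {A \<in> types. \<not> card (A \<inter> {..<m}) \<le> r}"
  define D1 where "D1 = card P1"
  have fin_types: "finite types"
    unfolding types_def by (rule finite_subset[of _ "Pow {..<k}"]) auto
  have cover: "{..<k} = {..<m} \<union> {m..<k}" using k by auto
  have card_types: "card types = D"
  proof -
    have "types = {A. A \<subseteq> {..<k} \<and> card A = s} - {A. A \<subseteq> {m..<k} \<and> card A = s}"
      unfolding types_def cover by auto
    also have "card \<dots> = card {A. A \<subseteq> {..<k} \<and> card A = s} - card {A. A \<subseteq> {m..<k} \<and> card A = s}"
    proof (rule card_Diff_subset)
      show "finite {A. A \<subseteq> {m..<k} \<and> card A = s}"
        by (rule finite_subset[of _ "Pow {m..<k}"]) auto
      show "{A. A \<subseteq> {m..<k} \<and> card A = s} \<subseteq> {A. A \<subseteq> {..<k} \<and> card A = s}"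
        unfolding cover by auto
    qed
    also have "\<dots> = D"
      using n_subsets[of "{..<k}" s] n_subsets[of "{m..<k}" s] by (simp add: D k)
    finally show ?thesis .
  qed
  have D12: "card P1 + card P2 = D"
  proof -
    have "P1 \<union> P2 = types" "P1 \<inter> P2 = {}" "finite P1" "finite P2"
      using fin_types by (auto simp: P1_def P2_def)
    then show ?thesis using card_Un_disjoint[of P1 P2] card_types by simp
  qed
  have fin12: "finite P1" "finite P2" using fin_types by (auto simp: P1_def P2_def)
  obtain e1 where e1: "bij_betw e1 {0..<D1} P1"
    using ex_bij_betw_nat_finite[OF fin12(1)] unfolding D1_def by auto
  obtain e2 where e2: "bij_betw e2 {0..<card P2} P2"
    using ex_bij_betw_nat_finite[OF fin12(2)] by auto
  \<comment> \<open>Early types are numbered before late ones, so conflicts are settled before the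
    first late block begins.\<close>
  define ty where "ty i = (if i < D1 then e1 i else e2 (i - D1))" for i
  have ty1: "ty i \<in> P1" if "i < D1" for i
    using that bij_betwE[OF e1] by (auto simp: ty_def)
  have ty2: "ty i \<in> P2" if "D1 \<le> i" "i < D" for i
    using that bij_betwE[OF e2] D12 by (auto simp: ty_def D1_def)
  have ty_types: "ty i \<in> types" if "i < D" for i
    using ty1[of i] ty2[of i] that by (cases "i < D1") (auto simp: P1_def P2_def)
  have ty_surj: "\<exists>i<D. ty i = A" if "A \<in> types" for A
  proof (cases "A \<in> P1")
    case True
    then have "A \<in> e1 ` {0..<D1}" using e1 by (simp add: bij_betw_def)
    then obtain i where "i < D1" "e1 i = A" by auto
    then show ?thesis using D12 by (intro exI[of _ i]) (auto simp: ty_def D1_def)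
  next
    case False
    then have "A \<in> P2" using that by (auto simp: P1_def P2_def)
    then have "A \<in> e2 ` {0..<card P2}" using e2 by (simp add: bij_betw_def)
    then obtain i where "i < card P2" "e2 i = A" by auto
    then show ?thesis using D12 by (intro exI[of _ "D1 + i"]) (auto simp: ty_def D1_def)
  qed

  \<comment> \<open>The target of an early type contains all its new vertices, so the remainder lies
    in the core. The target of a late type consists of new vertices only, so it reveals
    \<open>r\<close> coordinates of the tuple.\<close>
  define Qprop where "Qprop A Q \<longleftrightarrow> Q \<subseteq> A \<and> card Q = r \<and> (card (A \<inter> {..<m}) \<le> r \<longrightarrow> A \<inter> {..<m} \<subseteq> Q) \<and>
      (\<not> card (A \<inter> {..<m}) \<le> r \<longrightarrow> Q \<subseteq> {..<m})" for A Q
  define Q where "Q A = (SOME Q. Qprop A Q)" for A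
  have Q: "Qprop A (Q A)" if "A \<in> types" for A
  proof -
    have A: "finite A" "card A = s"
      using that by (auto simp: types_def intro: finite_subset[OF _ finite_lessThan])
    have "\<exists>Q. Qprop A Q"
    proof (cases "card (A \<inter> {..<m}) \<le> r")
      case True
      then obtain Q where "A \<inter> {..<m} \<subseteq> Q" "Q \<subseteq> A" "card Q = r"
        using exists_subset_between[of "A \<inter> {..<m}" r A] A rs by auto
      then show ?thesis using True by (auto simp: Qprop_def)
    next
      case False
      then obtain Q where "Q \<subseteq> A \<inter> {..<m}" "card Q = r"
        using exists_subset_between[of "{}" r "A \<inter> {..<m}"] A by auto
      then show ?thesis using False by (auto simp: Qprop_def)
    qed
    then show ?thesis unfolding Q_def by (rule someI_ex)
  qed
  define Rx where "Rx i = Q (ty i) \<inter> {..<m}" for i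
  have Rx1: "Rx i = ty i \<inter> {..<m}" "ty i - Q (ty i) \<subseteq> {m..<k}" if "i < D1" for i
  proof -
    have "ty i \<in> types" "card (ty i \<inter> {..<m}) \<le> r"
      using ty1[OF that] by (auto simp: P1_def)
    with Q[of "ty i"] have "Q (ty i) \<subseteq> ty i" "ty i \<inter> {..<m} \<subseteq> Q (ty i)"
      by (auto simp: Qprop_def)
    moreover have "ty i \<subseteq> {..<k}" using \<open>ty i \<in> types\<close> by (simp add: types_def)
    ultimately show "Rx i = ty i \<inter> {..<m}" "ty i - Q (ty i) \<subseteq> {m..<k}"
      unfolding Rx_def by force+
  qed
  have Rx2: "card (Rx i) = r" if "D1 \<le> i" "i < D" for i
  proof -
    have "ty i \<in> types" "\<not> card (ty i \<inter> {..<m}) \<le> r"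
      using ty2[OF that] by (auto simp: P2_def)
    with Q[of "ty i"] have "Q (ty i) \<subseteq> {..<m}" "card (Q (ty i)) = r"
      by (auto simp: Qprop_def)
    then show ?thesis by (simp add: Rx_def Int_absorb2)
  qed

  have finL: "finite L" using L finite_subset by blast
  have "card {m..<k} = card L" using L k by simp
  then obtain g where g: "bij_betw g {m..<k} L"
    using finite_same_card_bij[of "{m..<k}" L] finL by auto
  have "card {..<m * b} \<le> card ({1..n} - L)"
    using L finL n by (subst card_Diff_subset) auto
  then obtain \<phi> where \<phi>: "\<phi> ` {..<m * b} \<subseteq> {1..n} - L" "inj_on \<phi> {..<m * b}"
    using card_le_inj[of "{..<m * b}" "{1..n} - L"] by auto
  define V where "V = ({..<m} \<rightarrow>\<^sub>E {..<b})"
  \<comment> \<open>Under the injection \<open>\<phi>\<close> the classes are disjoint intervals of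
    length \<open>b\<close>, so a vertex reveals its coordinate, and two tuples share new vertices
    exactly where they agree.\<close>
  define emb where "emb v j = (if j < m then \<phi> (j * b + v j) else g j)" for v :: "nat \<Rightarrow> nat" and j
  have idx: "j * b + v j < m * b" "(j * b + v j) div b = j" if "v \<in> V" "j < m" for v j
  proof -
    have vj: "v j < b" using that by (auto simp: V_def)
    have "j * b + v j < Suc j * b" using vj by simp
    also have "\<dots> \<le> m * b" using that by (intro mult_le_mono1) simp
    finally show "j * b + v j < m * b" .
    show "(j * b + v j) div b = j" using vj by simp
  qed
  have emb_out: "emb v j \<in> {1..n} - L" if "v \<in> V" "j < m" for v j
    using \<phi>(1) idx(1)[OF that] that by (auto simp: emb_def)
  have emb_in: "emb v j \<in> L" "emb v j = g j" if "j \<in> {m..<k}" for v j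
    using bij_betwE[OF g] that by (auto simp: emb_def)
  have emb_eq: "j = j' \<and> v j = w j'"
    if "v \<in> V" "w \<in> V" "j < m" "j' < m" "emb v j = emb w j'" for v w j j'
  proof -
    have eq: "j * b + v j = j' * b + w j'"
      using that \<phi>(2) idx(1) by (auto simp: emb_def inj_on_def)
    then have "j = j'" using idx(2)[of v j] idx(2)[of w j'] that by simp
    then show ?thesis using eq by simp
  qed
  have emb_inj: "inj_on (emb v) {..<k}" if v: "v \<in> V" for v
  proof (rule inj_onI)
    fix j j' assume jj: "j \<in> {..<k}" "j' \<in> {..<k}" "emb v j = emb v j'"
    consider "j < m" "j' < m" | "j < m" "j' \<in> {m..<k}" | "j' < m" "j \<in> {m..<k}"
      | "j \<in> {m..<k}" "j' \<in> {m..<k}"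
      using jj by (cases "j < m"; cases "j' < m") auto
    then show "j = j'"
    proof cases
      case 1
      then show ?thesis using emb_eq[OF v v] jj by blast
    next
      case 2
      then show ?thesis using emb_out[OF v, of j] emb_in(1)[of j' v] jj by auto
    next
      case 3
      then show ?thesis using emb_out[OF v, of j'] emb_in(1)[of j v] jj by auto
    next
      case 4
      then show ?thesis using emb_in(2) g jj by (auto simp: bij_betw_def inj_on_def)
    qed
  qed
  have emb_range: "emb v ` {..<k} \<subseteq> {1..n}" if "v \<in> V" for v
    unfolding cover using emb_out[OF that] emb_in(1)[of _ v] L(1) by auto

  define tgt where "tgt i v = emb v ` Q (ty i)" for i v
  have Qk: "Q (ty i) \<subseteq> ty i" "ty i \<subseteq> {..<k}" "card (Q (ty i)) = r" "card (ty i) = s" if "i < D" for i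
    using Q[OF ty_types[OF that]] ty_types[OF that] by (auto simp: Qprop_def types_def)
  have tgtR: "tgt i v \<in> rsets n r" if "i < D" "v \<in> V" for i v
  proof -
    have "inj_on (emb v) (Q (ty i))"
      using emb_inj[OF that(2)] Qk[OF that(1)] by (auto intro: inj_on_subset)
    then show ?thesis
      using emb_range[OF that(2)] Qk[OF that(1)] by (auto simp: rsets_def tgt_def card_image)
  qed
  have same: "tgt i v = tgt i w \<longleftrightarrow> Rx i \<subseteq> agree m v w" if "i < D" "v \<in> V" "w \<in> V" for i v w
  proof
    assume eq: "tgt i v = tgt i w"
    show "Rx i \<subseteq> agree m v w"
    proof
      fix j assume "j \<in> Rx i"
      then have j: "j \<in> Q (ty i)" "j < m" by (auto simp: Rx_def)
      then have "emb v j \<in> tgt i w" unfolding eq[symmetric] by (simp add: tgt_def)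
      then obtain j' where j': "j' \<in> Q (ty i)" "emb v j = emb w j'" by (auto simp: tgt_def)
      have "j' < m"
      proof (rule ccontr)
        assume "\<not> j' < m"
        moreover have "j' < k" using j' Qk(1,2)[OF that(1)] by auto
        ultimately show False using emb_in(1)[of j' w] emb_out[OF that(2) j(2)] j' by auto
      qed
      then show "j \<in> agree m v w"
        using emb_eq[OF that(2,3) j(2) _ j'(2)] j(2) by (auto simp: agree_def)
    qed
  next
    assume sub: "Rx i \<subseteq> agree m v w"
    have "emb v j = emb w j" if "j \<in> Q (ty i)" for j
      using sub that by (auto simp: emb_def agree_def Rx_def)
    then show "tgt i v = tgt i w" unfolding tgt_def by (intro image_cong) auto
  qed

  define isolated where "isolated v xs \<longleftrightarrow> (\<forall>i<D1. tgt i v \<in> set (block T i xs)) \<and>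
      (\<forall>w\<in>V. w \<noteq> v \<longrightarrow> r \<le> card (agree m v w) \<longrightarrow> (\<exists>i<D1. tgt i w \<notin> set (block T i xs)))" for v xs
  \<comment> \<open>In an early block any tuple with the right target will do, in a late block only
    an isolated one. Without a candidate, \<open>\<sigma>\<close> plays the default
    \<open>\<delta>\<close>.\<close>
  define cand where "cand i xs U v \<longleftrightarrow> v \<in> V \<and> tgt i v = U \<and> (D1 \<le> i \<longrightarrow> isolated v xs)" for i xs U v
  obtain \<delta> where \<delta>: "admissible n r s \<delta>" using ex_admissible[of r s n] rs by fastforce
  define \<sigma> where "\<sigma> xs U = (let i = length xs div T in if i < D \<and> (\<exists>v. cand i xs U v)
      then emb (SOME v. cand i xs U v) ` (ty i - Q (ty i)) else \<delta> xs U)" for xs U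
  have adm: "admissible n r s \<sigma>"
    unfolding admissible_def
  proof (intro allI ballI)
    fix xs :: "nat set list" and U assume U: "U \<in> rsets n r"
    define i where "i = length xs div T"
    show "\<sigma> xs U \<subseteq> {1..n} - U \<and> card (\<sigma> xs U) = s - r"
    proof (cases "i < D \<and> (\<exists>v. cand i xs U v)")
      case True
      define v where "v = (SOME v. cand i xs U v)"
      have "cand i xs U v" unfolding v_def by (rule someI_ex[OF conjunct2[OF True]])
      then have v: "v \<in> V" "emb v ` Q (ty i) = U" by (auto simp: cand_def tgt_def)
      have eq: "\<sigma> xs U = emb v ` (ty i - Q (ty i))"
        using True by (simp add: \<sigma>_def Let_def i_def v_def)
      note Qi = Qk[of i]
      have inj: "inj_on (emb v) (ty i)"
        using emb_inj[OF v(1)] Qi True by (auto intro: inj_on_subset)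
      have "emb v ` (ty i - Q (ty i)) = emb v ` ty i - emb v ` Q (ty i)"
        using inj by (rule inj_on_image_set_diff) (use Qi True in auto)
      then have "\<sigma> xs U = emb v ` ty i - U" unfolding eq v(2) .
      moreover have "emb v ` ty i \<subseteq> {1..n}" using emb_range[OF v(1)] Qi True by auto
      moreover have "card (\<sigma> xs U) = s - r"
      proof -
        have "finite (ty i)" using Qi(2) True by (auto intro: finite_subset[OF _ finite_lessThan])
        moreover have "inj_on (emb v) (ty i - Q (ty i))" using inj by (rule inj_on_subset) auto
        ultimately show ?thesis
          unfolding eq using Qi True by (simp add: card_image card_Diff_subset finite_subset)
      qed
      ultimately show ?thesis by auto
    next
      case False
      have "\<sigma> xs U = \<delta> xs U"
        unfolding \<sigma>_def Let_def i_def[symmetric] by (rule if_not_P[OF False])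
      then show ?thesis using \<delta> U unfolding admissible_def by simp
    qed
  qed
  define h where "h I = card {i. i < D1 \<and> Rx i \<subseteq> I}" for I
  \<comment> \<open>For early types \<open>Rx i\<close> is the whole new part, so \<open>h I\<close>
    counts the early edges within \<open>I\<close> and the core.\<close>
  have h: "h I = early_count l r s (card I)" if "I \<subseteq> {..<m}" for I
  proof -
    have "{A \<in> P1. A \<inter> {..<m} \<subseteq> I} = ty ` {i. i < D1 \<and> Rx i \<subseteq> I}"
    proof -
      have "P1 = ty ` {..<D1}"
        using e1 by (auto simp: bij_betw_def ty_def lessThan_atLeast0)
      then show ?thesis using Rx1(1) by auto
    qed
    moreover have "inj_on ty {i. i < D1 \<and> Rx i \<subseteq> I}"
      using e1 by (auto simp: bij_betw_def ty_def inj_on_def)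
    ultimately have "h I = card {A \<in> P1. A \<inter> {..<m} \<subseteq> I}"
      unfolding h_def by (simp add: card_image)
    also have "{A \<in> P1. A \<inter> {..<m} \<subseteq> I}
        = {A. A \<subseteq> I \<union> {m..<k} \<and> card A = s \<and> A \<inter> I \<noteq> {} \<and> card (A \<inter> I) \<le> r}"
    proof -
      have eq: "A \<inter> {..<m} = A \<inter> I" if "A \<subseteq> I \<union> {m..<k} \<or> A \<inter> {..<m} \<subseteq> I" for A
        using \<open>I \<subseteq> {..<m}\<close> that by auto
      have sub: "A \<subseteq> {..<k} \<and> A \<inter> {..<m} \<subseteq> I \<longleftrightarrow> A \<subseteq> I \<union> {m..<k}" for A
        unfolding cover using \<open>I \<subseteq> {..<m}\<close> by auto
      show ?thesis unfolding P1_def types_def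
      proof (intro Collect_cong iffI, goal_cases)
        case (1 A)
        then show ?case using eq[of A] sub[of A] by auto
      next
        case (2 A)
        then show ?case using eq[of A] sub[of A] by auto
      qed
    qed
    also have "card \<dots> = early_count (card {m..<k}) r s (card I)"
      using that rs by (intro card_early) (auto intro: finite_subset[OF _ finite_lessThan])
    finally show ?thesis by (simp add: k)
  qed
  have D1: "D1 = early_count l r s m"
  proof -
    have "Rx i \<subseteq> {..<m}" for i by (auto simp: Rx_def)
    then have "h {..<m} = D1" by (simp add: h_def)
    then show ?thesis using h[of "{..<m}"] by simp
  qed
  have "\<mu> / (4 * (1 + 2 ^ m * C * \<mu>)) \<le> avg (rsets n r) (D * T) (\<lambda>xs. of_bool (\<exists>v\<in>V.
      (\<forall>i<D. tgt i v \<in> set (block T i xs)) \<and>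
      (\<forall>w\<in>V. w \<noteq> v \<longrightarrow> r \<le> card (agree m v w) \<longrightarrow> (\<exists>i<D1. tgt i w \<notin> set (block T i xs)))))"
    unfolding V_def
  proof (rule second_moment[where Rx = Rx and h = h and q = q and C = C])
    show "rsets n r \<noteq> {}" using rs by (intro rsets_nonempty) simp
    show "T \<le> card (rsets n r)" by (rule T)
    show "D1 \<le> D" using D12 by (simp add: D1_def)
    show "r \<le> card (Rx i)" if "D1 \<le> i" "i < D" for i using Rx2[OF that] by simp
    show "tgt i v \<in> rsets n r" if "i < D" "v \<in> {..<m} \<rightarrow>\<^sub>E {..<b}" for i v
      using tgtR that by (simp add: V_def)
    show "tgt i v = tgt i w \<longleftrightarrow> Rx i \<subseteq> agree m v w"
      if "i < D" "v \<in> {..<m} \<rightarrow>\<^sub>E {..<b}" "w \<in> {..<m} \<rightarrow>\<^sub>E {..<b}" for i v w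
      using same that by (simp add: V_def)
    show "real b ^ (m - card I) * q ^ (D1 - h I) \<le> 1 / 2 ^ (m + 1)"
      if "I \<subseteq> {..<m}" "r \<le> card I" "card I < m" for I
      using H1[OF that(2,3)] h[OF that(1)] D1 by simp
    show "1 \<le> C * (real b ^ card I * q ^ h I)" if "I \<subseteq> {..<m}" "card I < r" for I
      using H2[of "card I"] h[OF that(1)] card_mono[OF _ that(1)] by simp
  qed (use q C mu in \<open>auto simp: h_def\<close>)
  also have "\<dots> \<le> avg (rsets n r) (D * T)
    (\<lambda>Us. of_bool (has_clique n k s ({e. e \<subseteq> L \<and> card e = s} \<union> edge_set \<sigma> Us)))"
  proof (rule avg_mono)
    fix xs assume xs: "xs \<in> words (rsets n r) (D * T)"
    have "has_clique n k s ({e. e \<subseteq> L \<and> card e = s} \<union> edge_set \<sigma> xs)"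
      if v: "v \<in> V" and hits: "\<And>i. i < D \<Longrightarrow> tgt i v \<in> set (block T i xs)"
        and iso: "\<forall>w\<in>V. w \<noteq> v \<longrightarrow> r \<le> card (agree m v w) \<longrightarrow> (\<exists>i<D1. tgt i w \<notin> set (block T i xs))"
      for v
      unfolding has_clique_def
    proof (intro exI conjI allI impI)
      show "emb v ` {..<k} \<subseteq> {1..n}" by (rule emb_range[OF v])
      show "card (emb v ` {..<k}) = k" using emb_inj[OF v] by (simp add: card_image)
      fix e assume e: "e \<subseteq> emb v ` {..<k} \<and> card e = s"
      then obtain A where A: "A \<subseteq> {..<k}" "e = emb v ` A" by (auto simp: subset_image_iff)
      have cardA: "card A = s"
        using e A emb_inj[OF v] by (metis card_image inj_on_subset)
      show "e \<in> {e. e \<subseteq> L \<and> card e = s} \<union> edge_set \<sigma> xs"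
      proof (cases "A \<inter> {..<m} = {}")
        case True
        then have "A \<subseteq> {m..<k}" using A(1) unfolding cover by auto
        then have "e \<subseteq> L" unfolding A(2) using emb_in(1) by auto
        then show ?thesis using e by simp
      next
        case False
        then have "A \<in> types" using A cardA by (simp add: types_def)
        then obtain i where i: "i < D" "ty i = A" using ty_surj by auto
        obtain p' where p': "p' < length (block T i xs)" "block T i xs ! p' = tgt i v"
          using hits[OF i(1)] by (auto simp: in_set_conv_nth)
        define p where "p = i * T + p'"
        have "p' < T" "p < length xs" using p' by (auto simp: block_def p_def)
        moreover have "i * T \<le> length xs" using p'(1) by (auto simp: block_def)
        then have xp: "xs ! p = tgt i v"
          using p' by (simp add: block_def p_def)
        moreover have pdiv: "p div T = i" using \<open>p' < T\<close> by (simp add: p_def)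
        ultimately have len: "length (take p xs) = p" by simp
        \<comment> \<open>In a late block all early blocks lie in the past, so isolation judged from
          the prefix agrees with isolation in the whole word.\<close>
        have blk: "block T j (take p xs) = block T j xs" if "D1 \<le> i" "j < D1" for j
        proof -
          have "Suc j * T \<le> i * T" using that by (intro mult_le_mono1) simp
          then have "j * T + T \<le> p" by (simp add: p_def)
          then have "drop (j * T) (take p xs) = take (p - j * T) (drop (j * T) xs)" "T \<le> p - j * T"
            by (auto simp: drop_take)
          then show ?thesis by (simp add: block_def min_def)
        qed
        have D1D: "D1 \<le> D" using D12 by (simp add: D1_def)
        have isov: "isolated v xs" unfolding isolated_def using hits iso D1D by auto
        have isotake: "isolated w (take p xs) \<longleftrightarrow> isolated w xs" if "D1 \<le> i" for w
          unfolding isolated_def using blk[OF that] by (simp cong: conj_cong)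
        define U where "U = xs ! p"
        have "cand i (take p xs) U v"
          using v xp isotake isov by (auto simp: cand_def U_def)
        then have ex: "\<exists>v. cand i (take p xs) U v" by auto
        \<comment> \<open>The candidate \<open>w\<close> picked by the strategy may differ from
          \<open>v\<close>; it only has to produce the same edge.\<close>
        define w where "w = (SOME v. cand i (take p xs) U v)"
        have "cand i (take p xs) U w" unfolding w_def by (rule someI_ex[OF ex])
        then have w: "w \<in> V" "tgt i w = tgt i v" "D1 \<le> i \<Longrightarrow> isolated w xs"
          using isotake xp by (auto simp: cand_def U_def)
        have "\<sigma> (take p xs) U = emb w ` (A - Q A)"
          using ex i len pdiv unfolding \<sigma>_def w_def by (simp add: Let_def)
        also have "\<dots> = emb v ` (A - Q A)"
        proof (cases "i < D1")
          \<comment> \<open>The completion uses core labels only, which every tuple embeds in the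
            same way.\<close>
          case True
          then have "A - Q A \<subseteq> {m..<k}" using Rx1(2) i by auto
          then show ?thesis using emb_in(2) by (intro image_cong) auto
        next
          case False
          \<comment> \<open>Equal late targets force agreement on \<open>r\<close> coordinates. If
            \<open>w\<close> were not \<open>v\<close>, isolation of \<open>w\<close> would make
            \<open>v\<close> miss an early target, but all targets of \<open>v\<close> are
            hit.\<close>
          have "w = v"
          proof (rule ccontr)
            assume "w \<noteq> v"
            have "Rx i \<subseteq> agree m w v" using same[OF i(1) w(1) v] w(2) by simp
            then have "card (Rx i) \<le> card (agree m w v)"
              using agree_subset[of m w v] by (intro card_mono) (auto intro: finite_subset[OF _ finite_lessThan])
            then have "r \<le> card (agree m w v)" using Rx2[of i] False i by simp
            with w(3) False \<open>w \<noteq> v\<close> v have "\<exists>j<D1. tgt j v \<notin> set (block T j xs)"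
              by (auto simp: isolated_def)
            then show False using hits D1D by auto
          qed
          then show ?thesis by simp
        qed
        finally have "U \<union> \<sigma> (take p xs) U = emb v ` Q A \<union> emb v ` (A - Q A)"
          using xp i by (simp add: U_def tgt_def)
        also have "\<dots> = e"
          using A(2) Qk(1)[OF i(1)] i(2) by auto
        finally have "e = xs ! p \<union> \<sigma> (take p xs) (xs ! p)" by (simp add: U_def)
        then show ?thesis using \<open>p < length xs\<close> by (auto simp: edge_set_def)
      qed
    qed
    then show "of_bool (\<exists>v\<in>V. (\<forall>i<D. tgt i v \<in> set (block T i xs)) \<and>
        (\<forall>w\<in>V. w \<noteq> v \<longrightarrow> r \<le> card (agree m v w) \<longrightarrow> (\<exists>i<D1. tgt i w \<notin> set (block T i xs))))
      \<le> (of_bool (has_clique n k s ({e. e \<subseteq> L \<and> card e = s} \<union> edge_set \<sigma> xs)) :: real)"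
      by auto
  qed
  finally show ?thesis using adm by (intro exI conjI)
qed

subsection \<open>Exponents\<close>

text \<open>The mean slope to the left of \<open>b\<close> is at most the increment at
  \<open>b\<close>, which is at most the mean slope to its right. Cross-multiplication admits the
  degenerate cases \<open>a = b\<close> and \<open>b = c\<close>.\<close>

lemma convex_slopes:
  fixes g :: "nat \<Rightarrow> real"
  assumes inc: "\<And>i j. i \<le> j \<Longrightarrow> g (Suc i) - g i \<le> g (Suc j) - g j" and le: "a \<le> b" "b \<le> c"
  shows "(g b - g a) * real (c - b) \<le> (g c - g b) * real (b - a)"
proof -
  define d where "d = g (Suc b) - g b"
  have "g b - g a = (\<Sum>i=a..<b. g (Suc i) - g i)" using le by (simp add: sum_Suc_diff')
  also have "\<dots> \<le> real (card {a..<b}) * d" unfolding d_def by (intro sum_bounded_above inc) simp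
  finally have lo: "g b - g a \<le> real (b - a) * d" by simp
  have "real (card {b..<c}) * d \<le> (\<Sum>i=b..<c. g (Suc i) - g i)"
    unfolding d_def by (intro sum_bounded_below inc) simp
  also have "\<dots> = g c - g b" using le by (simp add: sum_Suc_diff')
  finally have hi: "real (c - b) * d \<le> g c - g b" by simp
  have "(g b - g a) * real (c - b) \<le> real (b - a) * d * real (c - b)"
    using lo by (intro mult_right_mono) auto
  also have "\<dots> = (real (c - b) * d) * real (b - a)" by simp
  also have "\<dots> \<le> (g c - g b) * real (b - a)" using hi by (intro mult_right_mono) auto
  finally show ?thesis .
qed

text \<open>By Pascal's rule the increments are binomials with lower index s - 1, which are
  monotone.\<close>

lemma binomial_increments:
  assumes "0 < s" "i \<le> j"
  shows "real (Suc i choose s) - real (i choose s) \<le> real (Suc j choose s) - real (j choose s)"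
proof -
  obtain s' where "s = Suc s'" using assms(1) gr0_implies_Suc by blast
  then show ?thesis using binomial_right_mono[OF assms(2), of s'] by simp
qed

lemma binomial_strict_mono:
  assumes "0 < s" "s \<le> k" "l < k"
  shows "l choose s < k choose s"
proof -
  obtain k' where k': "k = Suc k'" using assms gr0_implies_Suc[of k] by auto
  obtain s' where s': "s = Suc s'" using assms gr0_implies_Suc[of s] by auto
  have "l choose s \<le> k' choose s" using assms k' by (intro binomial_right_mono) simp
  moreover have "0 < k' choose s'" using assms k' s' by simp
  ultimately show ?thesis unfolding k' s' binomial_Suc_Suc by linarith
qed

text \<open>Absorption: s times (k choose s) is k times (k-1 choose s-1), and the latter binomial is
  at least s because k - 1 >= s.\<close>

lemma binomial_ge_self:
  assumes "0 < s" "s < k"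
  shows "k \<le> k choose s"
proof -
  obtain k' where k': "k = Suc k'" using assms gr0_implies_Suc[of k] by auto
  obtain s' where s': "s = Suc s'" using assms gr0_implies_Suc[of s] by auto
  have "Suc s' choose s' \<le> k' choose s'" using assms k' s' by (intro binomial_right_mono) simp
  then have "Suc s' \<le> k' choose s'" by (simp add: binomial_symmetric[of s' "Suc s'"])
  then have "Suc k' * Suc s' \<le> Suc k' * (k' choose s')" by (rule mult_le_mono2)
  then have "k * s \<le> (k choose s) * s"
    using Suc_times_binomial[of s' k'] by (simp only: k' s' mult.commute)
  then show ?thesis using assms by simp
qed

text \<open>New vertices per missing edge, the inverse slope of the chord of (i choose s) between
  \<open>l\<close> and \<open>k\<close>. Hit probabilities of order n^(-theta) make the expected
  number of completed cliques on a given core constant in order.\<close>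

definition theta :: "nat \<Rightarrow> nat \<Rightarrow> nat \<Rightarrow> real" where
  "theta k l s = (real k - real l) / (real (k choose s) - real (l choose s))"

lemma theta_pos:
  assumes "0 < s" "s \<le> k" "l < k"
  shows "0 < theta k l s"
  using assms binomial_strict_mono[OF assms] by (simp add: theta_def)

text \<open>By convexity the chord over [l, k] is at least as steep as the one over [0, k], whose
  slope (k choose s)/k is at least 1.\<close>

lemma theta_le_1:
  assumes "0 < s" "s < k" "l < k"
  shows "theta k l s \<le> 1"
proof -
  have "(real (l choose s) - real (0 choose s)) * real (k - l)
      \<le> (real (k choose s) - real (l choose s)) * real (l - 0)"
    by (rule convex_slopes[where g = "\<lambda>i. real (i choose s)"])
       (use assms binomial_increments in auto)
  then have "real (l choose s) * (real k - real l) \<le> (real (k choose s) - real (l choose s)) * real l"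
    using assms by (simp add: binomial_eq_0 of_nat_diff)
  then have "real (k choose s) * (real k - real l) \<le> (real (k choose s) - real (l choose s)) * real k"
    by (simp add: algebra_simps)
  moreover have "real k * (real k - real l) \<le> real (k choose s) * (real k - real l)"
    using assms binomial_ge_self[of s k] by (intro mult_right_mono) auto
  ultimately have "real k * (real k - real l) \<le> real k * (real (k choose s) - real (l choose s))"
    by (simp only: mult.commute)
  then have "real k - real l \<le> real (k choose s) - real (l choose s)"
    using assms by simp
  then show ?thesis
    using binomial_strict_mono[of s k l] assms by (simp add: theta_def)
qed

text \<open>The chord from \<open>l'\<close> to \<open>l\<close> is at most as steep as the next one
  from \<open>l\<close> to \<open>k\<close>. In the recursion this means that building the core
  takes no longer than extending it.\<close>

lemma theta_antimono:
  assumes "0 < s" "s \<le> l" "l' < l" "l < k"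
  shows "theta k l s \<le> theta l l' s"
proof -
  have "(real (l choose s) - real (l' choose s)) * real (k - l)
      \<le> (real (k choose s) - real (l choose s)) * real (l - l')"
    by (rule convex_slopes[where g = "\<lambda>i. real (i choose s)"])
       (use assms binomial_increments in auto)
  moreover have "0 < real (l choose s) - real (l' choose s)" "0 < real (k choose s) - real (l choose s)"
    using binomial_strict_mono[of s l l'] binomial_strict_mono[of s k l] assms by auto
  ultimately show ?thesis
    using assms by (simp add: theta_def frac_le_eq divide_simps of_nat_diff mult.commute)
qed

text \<open>A convex function lies below its chord. Hence no set of \<open>i\<close> new vertices is
  a bottleneck whose partial structure is expected too rarely.\<close>

lemma theta_scaled_le:
  assumes "0 < s" "s \<le> l + m" "0 < m" "i \<le> m"
  shows "theta (l + m) l s * (real (l + i choose s) - real (l choose s)) \<le> real i"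
proof -
  have "(real (l + i choose s) - real (l choose s)) * real (l + m - (l + i))
      \<le> (real (l + m choose s) - real (l + i choose s)) * real (l + i - l)"
    by (rule convex_slopes[where g = "\<lambda>i. real (i choose s)"])
       (use assms binomial_increments in auto)
  then have "(real (l + i choose s) - real (l choose s)) * (real m - real i)
      \<le> (real (l + m choose s) - real (l + i choose s)) * real i"
    using assms by (simp add: of_nat_diff)
  then have "real m * (real (l + i choose s) - real (l choose s))
      \<le> real i * (real (l + m choose s) - real (l choose s))"
    by (simp add: algebra_simps)
  moreover have "0 < real (l + m choose s) - real (l choose s)"
    using binomial_strict_mono[of s "l + m" l] assms by auto
  ultimately show ?thesis by (simp add: theta_def pos_divide_le_eq)
qed

section \<open>Convexity of the early edge counts\<close>

lemma early_count_le:
  assumes "r \<le> s"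
  shows "early_count l r s i + (l choose s) \<le> l + i choose s"
proof -
  have "early_count l r s i + (l choose s) = (\<Sum>j\<in>insert 0 {1..r}. (i choose j) * (l choose (s - j)))"
    by (simp add: early_count_def mult.commute)
  also have "\<dots> \<le> (\<Sum>j\<le>s. (i choose j) * (l choose (s - j)))"
    using assms by (intro sum_mono2) auto
  also have "\<dots> = l + i choose s" by (simp add: vandermonde add.commute)
  finally show ?thesis .
qed

lemma early_count_mono: "i \<le> j \<Longrightarrow> early_count l r s i \<le> early_count l r s j"
  unfolding early_count_def by (intro sum_mono mult_le_mono2 binomial_right_mono)

text \<open>\<open>early_count\<close> is convex in \<open>i\<close>, being a nonnegative
  combination of binomials, so the chord from \<open>i\<close> to \<open>m\<close> is at least as
  steep as that from \<open>r\<close> to \<open>m\<close>. The hypothesis \<open>cond\<close> comes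
  from the inequality defining \<ell>, and this carries it over to all larger
  \<open>i\<close>.\<close>

lemma early_count_gap:
  assumes "r < m" "r \<le> i" "i \<le> m" "0 \<le> \<theta>"
    and cond: "real m - real r \<le> \<theta> * (real (early_count l r s m) - real (early_count l r s r))"
  shows "real m - real i \<le> \<theta> * (real (early_count l r s m) - real (early_count l r s i))"
proof -
  let ?g = "\<lambda>i. real (early_count l r s i)"
  have "(?g i - ?g r) * real (m - i) \<le> (?g m - ?g i) * real (i - r)"
  proof (rule convex_slopes)
    fix i j :: nat assume "i \<le> j"
    have "?g (Suc i) - ?g i = (\<Sum>t=1..r. real (l choose (s - t)) * (real (Suc i choose t) - real (i choose t)))"
      for i by (simp add: early_count_def sum_subtractf right_diff_distrib)
    then show "?g (Suc i) - ?g i \<le> ?g (Suc j) - ?g j"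
      using binomial_increments[OF _ \<open>i \<le> j\<close>] by (simp only:) (intro sum_mono mult_left_mono, auto)
  qed (use assms in auto)
  then have "(?g m - ?g r) * (real m - real i) \<le> (?g m - ?g i) * (real m - real r)"
    using assms by (simp add: of_nat_diff algebra_simps)
  then have "\<theta> * ((?g m - ?g r) * (real m - real i)) \<le> \<theta> * ((?g m - ?g i) * (real m - real r))"
    using assms by (intro mult_left_mono)
  moreover have "(real m - real r) * (real m - real i) \<le> \<theta> * (?g m - ?g r) * (real m - real i)"
    using cond assms by (intro mult_right_mono) auto
  ultimately have "(real m - real r) * (real m - real i) \<le> (real m - real r) * (\<theta> * (?g m - ?g i))"
    by (simp add: mult_ac)
  then show ?thesis using assms by (simp only: mult_le_cancel_left_pos[of "real m - real r"] of_nat_less_iff diff_gt_0_iff_gt)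
qed

section \<open>Block lengths and class sizes\<close>

lemma floor_ge_half:
  fixes y :: real
  assumes "1 \<le> y"
  shows "y / 2 \<le> real (nat \<lfloor>y\<rfloor>)" "real (nat \<lfloor>y\<rfloor>) \<le> y"
proof -
  have "1 \<le> \<lfloor>y\<rfloor>" using assms by simp
  then have "real (nat \<lfloor>y\<rfloor>) = of_int \<lfloor>y\<rfloor>" "1 \<le> real_of_int \<lfloor>y\<rfloor>" by auto
  moreover have "y < of_int \<lfloor>y\<rfloor> + 1" "of_int \<lfloor>y\<rfloor> \<le> y" by linarith+
  ultimately show "y / 2 \<le> real (nat \<lfloor>y\<rfloor>)" "real (nat \<lfloor>y\<rfloor>) \<le> y" by linarith+
qed

lemma div_ge_half:
  fixes n l m :: nat
  assumes "0 < m" "2 * (l + m) \<le> n"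
  shows "real n / (2 * real m) \<le> real ((n - l) div m)"
proof -
  define d where "d = (n - l) div m"
  have "n - l < d * m + m"
    unfolding d_def using assms(1) by (metis add.commute dividend_less_div_times mult.commute)
  then have "n < d * m + m + l" by linarith
  then have "real n < real d * real m + real m + real l"
    by (simp flip: of_nat_mult of_nat_add)
  moreover have "2 * (real l + real m) \<le> real n"
    using of_nat_mono[OF assms(2), where 'a = real] by simp
  moreover have "x \<le> 2 * y" if "x < y + m' + l'" "2 * (l' + m') \<le> x" for x y m' l' :: real
    using that by simp
  ultimately have "real n \<le> 2 * (real d * real m)" by blast
  then show ?thesis using assms(1) unfolding d_def[symmetric] by (simp add: divide_simps mult_ac)
qed

text \<open>The number before rounding is at least 1, since (n choose r) >= (n/r)^2, n^(-\<theta>)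
  >= 1/n and \<open>large\<close> holds. So rounding down loses at most a factor 2; with the factor
  2 from \<open>hit_prob_bounds\<close> this gives the 4.\<close>

lemma draws_bounds:
  fixes n r :: nat and \<delta> \<theta> :: real
  assumes r: "2 \<le> r" "r \<le> n" and \<theta>: "0 \<le> \<theta>" "\<theta> \<le> 1" and \<delta>: "0 < \<delta>" "\<delta> \<le> 1"
    and large: "(real r)\<^sup>2 \<le> \<delta> * real n"
  defines "x \<equiv> real n powr - \<theta>" and "T \<equiv> nat \<lfloor>\<delta> * real (n choose r) * real n powr - \<theta>\<rfloor>"
  shows "0 < T" "T \<le> n choose r" "real T \<le> real n powr (real r - \<theta>)"
    "\<delta> * x / 4 \<le> hit_prob (n choose r) T" "hit_prob (n choose r) T \<le> \<delta> * x"
proof -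
  let ?N = "real (n choose r)"
  define y where "y = \<delta> * ?N * x"
  have n1: "1 \<le> real n" using r by simp
  have N1: "1 \<le> ?N" using r by (simp add: Suc_le_eq)
  have x1: "x \<le> 1" "0 < x" using powr_mono[of "-\<theta>" 0 "real n"] n1 \<theta> r by (auto simp: x_def)
  have xn: "1 / real n \<le> x"
    using powr_mono[of "-1" "-\<theta>" "real n"] n1 \<theta> by (simp add: x_def powr_minus_divide)
  have "1 \<le> real n / real r" using r by simp
  then have "(real n / real r)\<^sup>2 \<le> (real n / real r) ^ r" using r by (intro power_increasing) auto
  also have "\<dots> \<le> ?N" using binomial_ge_n_over_k_pow_k[of r n, where 'a = real] r by simp
  finally have N2: "(real n / real r)\<^sup>2 \<le> ?N" .
  have "1 \<le> \<delta> * (real n / real r)\<^sup>2 * (1 / real n)"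
    using large n1 r by (simp add: power2_eq_square field_simps)
  also have "\<dots> \<le> y"
    unfolding y_def using N2 xn \<delta> by (intro mult_mono) auto
  finally have y1: "1 \<le> y" .
  have T: "T = nat \<lfloor>y\<rfloor>" by (simp add: T_def y_def x_def)
  have Ty: "y / 2 \<le> real T" "real T \<le> y" unfolding T using floor_ge_half[OF y1] by auto
  show "0 < T" using Ty y1 by linarith
  have "\<delta> * x \<le> 1" using \<delta> x1 by (intro mult_le_one) auto
  then have "y \<le> ?N" using N1 mult_left_mono[of "\<delta> * x" 1 ?N] by (simp add: y_def mult_ac)
  then have TN: "real T \<le> ?N" using Ty by simp
  then show "T \<le> n choose r" by simp
  have "y \<le> ?N * x"
    using mult_right_mono[of \<delta> 1 "?N * x"] \<delta> N1 x1 by (simp add: y_def mult.assoc)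
  also have "\<dots> \<le> real (n ^ r) * x"
    using binomial_le_pow[OF r(2)] x1 by (intro mult_right_mono) (auto simp only: of_nat_le_iff)
  also have "\<dots> = real n powr (real r - \<theta>)"
    using n1 powr_add[of "real n" "real r" "- \<theta>"] by (simp add: x_def powr_realpow)
  finally show "real T \<le> real n powr (real r - \<theta>)" using Ty by simp
  have cancel: "\<delta> * N * x / N = \<delta> * x" if "1 \<le> N" for N using that by simp
  have "\<delta> * x / 4 = (y / 2) / (2 * ?N)" using cancel[OF N1] r(2) by (simp add: y_def)
  also have "\<dots> \<le> real T / (2 * ?N)" using Ty N1 by (intro divide_right_mono) auto
  also have "\<dots> \<le> hit_prob ?N T" using hit_prob_bounds(4)[OF N1 TN] .
  finally show "\<delta> * x / 4 \<le> hit_prob (n choose r) T" .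
  have "hit_prob ?N T \<le> real T / ?N" using hit_prob_bounds(3)[OF N1 TN] .
  also have "\<dots> \<le> y / ?N" using Ty N1 by (intro divide_right_mono) auto
  also have "\<dots> = \<delta> * x" unfolding y_def using N1 by (metis less_le_trans less_irrefl mult.commute mult.left_commute nonzero_mult_div_cancel_left zero_less_one)
  finally show "hit_prob (n choose r) T \<le> \<delta> * x" .
qed

text \<open>Fixes the constants for \<open>extend_core\<close>, with classes of order n and hit
  probability of order n^(-\<theta>). Upper bounds through \<delta> give \<open>H1\<close>, lower
  bounds through \<kappa> give \<open>H2\<close> with C = 1/\<kappa>; the result is then composed
  with the strategy for the core.\<close>

lemma achievable_extend:
  fixes r s l m :: nat
  defines "\<theta> \<equiv> theta (l + m) l s"
  assumes rs: "2 \<le> r" "r < s" "s < l + m" "r \<le> m"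
    and cond: "real m - real r \<le> \<theta> * (real (early_count l r s m) - real (early_count l r s r))"
    and core: "achievable r s l (real r - \<theta>)"
  shows "achievable r s (l + m) (real r - \<theta>)"
proof -
  define E where "E = early_count l r s"
  define D where "D = ((l + m) choose s) - (l choose s)"
  \<comment> \<open>Shortening the blocks by \<delta> puts this factor into \<open>q\<close>, and a
    single such factor is the bound that \<open>H1\<close> asks for.\<close>
  define \<delta> where "\<delta> = 1 / 2 ^ (m + 1) * (1 :: real)"
  \<comment> \<open>A common lower bound for b^i q^e whenever \<theta> e <= i, from b >= n/(2m) and
    q >= \<delta> n^(-\<theta>)/4. The largest exponents \<open>m\<close> and \<open>D\<close> cover
    all cases because both bases are at most 1.\<close>
  define \<kappa> where "\<kappa> = (1 / (2 * real m)) ^ m * (\<delta> / 4) ^ D"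
  have m: "0 < m" using rs by simp
  have \<theta>: "0 < \<theta>" "\<theta> \<le> 1"
    unfolding \<theta>_def using rs m by (auto intro!: theta_pos theta_le_1)
  have "(1 :: real) \<le> 2 ^ (m + 1)" by (rule one_le_power) simp
  then have \<delta>: "0 < \<delta>" "\<delta> \<le> 1" by (simp_all add: \<delta>_def)
  have \<kappa>: "0 < \<kappa>" using m \<delta> by (simp add: \<kappa>_def)
  have Dreal: "real D = real (l + m choose s) - real (l choose s)"
    using binomial_strict_mono[of s "l + m" l] rs m by (simp add: D_def of_nat_diff)
  have \<theta>D: "\<theta> * real D = real m"
    using binomial_strict_mono[of s "l + m" l] rs m by (simp add: \<theta>_def theta_def Dreal)
  have E_le: "E i + (l choose s) \<le> l + i choose s" for i
    unfolding E_def using rs by (intro early_count_le) simp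
  have \<theta>E: "\<theta> * real (E i) \<le> real i" if "i \<le> m" for i
  proof -
    have "real (E i) \<le> real (l + i choose s) - real (l choose s)"
      using E_le[of i] by linarith
    then have "\<theta> * real (E i) \<le> \<theta> * (real (l + i choose s) - real (l choose s))"
      using \<theta> by (intro mult_left_mono) auto
    also have "\<dots> \<le> real i" unfolding \<theta>_def using rs m that by (intro theta_scaled_le) auto
    finally show ?thesis .
  qed
  have E_D: "E i \<le> D" if "i \<le> m" for i
  proof -
    have "E i \<le> E m" unfolding E_def using that by (rule early_count_mono)
    then show ?thesis using E_le[of m] by (simp add: D_def)
  qed
  have gap: "real m - real i \<le> \<theta> * real (E m - E i)" if "r \<le> i" "i < m" for i
    using early_count_gap[of r m i \<theta> l s] early_count_mono[of i m l r s] that cond \<theta>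
    by (simp add: E_def of_nat_diff)

  obtain c1 C1 N1 where c1: "c1 > 0" and ach: "\<And>n. n \<ge> N1 \<Longrightarrow> \<exists>t \<sigma>. admissible n r s \<sigma> \<and>
     real t \<le> C1 * real n powr (real r - \<theta>) \<and> c1 \<le> success n r s l \<sigma> t"
    using core unfolding achievable_def by metis
  \<comment> \<open>The bound of \<open>extend_core\<close> with C = 1/\<kappa> increases with
    \<mu>; this is its value at the least possible \<mu> = \<kappa>.\<close>
  define c2 where "c2 = \<kappa> / (4 * (1 + 2 ^ m))"
  have c2: "0 < c2" using \<kappa> by (simp add: c2_def add_pos_pos)
  define N where "N = Max {N1, r, s, 2 * (l + m), r\<^sup>2 * 2 ^ (m + 1)}"
  show ?thesis
  proof (rule achievableI[where c = "c1 * c2" and N = N and C = "C1 + real D"])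
    show "0 < c1 * c2" using c1 c2 by simp
    fix n assume "n \<ge> N"
    then have n: "N1 \<le> n" "r \<le> n" "s \<le> n" "2 * (l + m) \<le> n" "r\<^sup>2 * 2 ^ (m + 1) \<le> n"
      by (auto simp: N_def)
    have n1: "1 \<le> real n" using n rs by simp
    define x where "x = real n powr - \<theta>"
    define T where "T = nat \<lfloor>\<delta> * real (n choose r) * real n powr - \<theta>\<rfloor>"
    define q where "q = hit_prob (n choose r) T"
    define b where "b = (n - l) div m"
    have "real (r\<^sup>2 * 2 ^ (m + 1)) \<le> real n" using n(5) by (simp only: of_nat_le_iff)
    then have "(real r)\<^sup>2 \<le> \<delta> * real n"
      by (simp add: \<delta>_def divide_simps mult_ac)
    note T = draws_bounds[OF rs(1) n(2) less_imp_le[OF \<theta>(1)] \<theta>(2) \<delta> this, folded T_def, folded x_def q_def]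
    have x: "0 < x" using n1 by (simp add: x_def)
    have q: "0 < q" using T(4) x \<delta> by (auto intro: less_le_trans[of 0 "\<delta> * x / 4"])
    have xp: "x ^ e = real n powr (- \<theta> * real e)" for e
      using n1 by (simp add: x_def powr_powr flip: powr_realpow)
    have nxp: "real n ^ i * x ^ e = real n powr (real i - \<theta> * real e)" for i e
      using n1 by (simp add: xp powr_realpow[symmetric] flip: powr_add)
    have b_lower: "real n / (2 * real m) \<le> real b" unfolding b_def using m n(4) by (rule div_ge_half)
    have b_upper: "real b \<le> real n"
    proof -
      have "b \<le> n - l" unfolding b_def by (rule div_le_dividend)
      then show ?thesis by simp
    qed
    have mb: "l + m * b \<le> n"
    proof -
      have "l + y \<le> n" if "y \<le> n - l" for y using that n(4) by simp
      then show ?thesis unfolding b_def using times_div_less_eq_dividend by blast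
    qed

    have weight: "\<kappa> \<le> real b ^ i * q ^ e" if "i \<le> m" "e \<le> D" "\<theta> * real e \<le> real i" for i e
    proof -
      have "\<kappa> \<le> (1 / (2 * real m)) ^ i * (\<delta> / 4) ^ e"
        unfolding \<kappa>_def using that m \<delta> by (intro mult_mono power_decreasing) auto
      also have "\<dots> \<le> (1 / (2 * real m)) ^ i * (\<delta> / 4) ^ e * (real n powr (real i - \<theta> * real e))"
      proof -
        have "1 \<le> real n powr (real i - \<theta> * real e)"
          using n1 that by (intro ge_one_powr_ge_zero) auto
        moreover have "0 \<le> (1 / (2 * real m)) ^ i * (\<delta> / 4) ^ e" using \<delta> by simp
        ultimately show ?thesis by (metis mult.right_neutral mult_left_mono)
      qed
      also have "\<dots> = (real n / (2 * real m)) ^ i * (\<delta> * x / 4) ^ e"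
        unfolding nxp[symmetric] by (simp add: power_divide power_mult_distrib)
      also have "\<dots> \<le> real b ^ i * q ^ e"
        using b_lower T(4) \<delta> x m by (intro mult_mono power_mono) auto
      finally show ?thesis .
    qed
    define \<mu> where "\<mu> = real b ^ m * q ^ D"
    have \<mu>: "\<kappa> \<le> \<mu>" unfolding \<mu>_def using weight[of m D] \<theta>D by simp

    have ext: "\<exists>\<tau>. admissible n r s \<tau> \<and> c2 \<le> avg (rsets n r) (D * T)
        (\<lambda>Us. of_bool (has_clique n (l + m) s ({e. e \<subseteq> L \<and> card e = s} \<union> edge_set \<tau> Us)))"
      if L: "L \<subseteq> {1..n}" "card L = l" for L
    proof -
      have "\<exists>\<tau>. admissible n r s \<tau> \<and> \<mu> / (4 * (1 + 2 ^ m * (1 / \<kappa>) * \<mu>)) \<le> avg (rsets n r) (D * T)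
        (\<lambda>Us. of_bool (has_clique n (l + m) s ({e. e \<subseteq> L \<and> card e = s} \<union> edge_set \<tau> Us)))"
      proof (rule extend_core[OF rs(2) n(3) refl mb L])
        show "0 < T" "T \<le> card (rsets n r)" using T(1,2) by (auto simp: card_rsets)
        show "q = hit_prob (card (rsets n r)) T" by (simp add: q_def card_rsets)
        show "real b ^ (m - i) * q ^ (early_count l r s m - early_count l r s i) \<le> 1 / 2 ^ (m + 1)"
          if i: "r \<le> i" "i < m" for i
        proof -
          let ?d = "E m - E i"
          \<comment> \<open>As i < m, \<open>gap\<close> forces a positive difference, so at least
            one factor \<delta> is available. The remaining power of n has a nonpositive exponent,
            again by \<open>gap\<close>.\<close>
          have "?d \<noteq> 0" using gap[OF i] i by (intro notI) simp
          have "real b ^ (m - i) * q ^ ?d \<le> real n ^ (m - i) * (\<delta> * x) ^ ?d"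
            using b_upper T(5) q by (intro mult_mono power_mono) auto
          also have "\<dots> = \<delta> ^ ?d * (real n powr (real (m - i) - \<theta> * real ?d))"
            unfolding nxp[symmetric] by (simp add: power_mult_distrib)
          also have "\<dots> \<le> \<delta> ^ 1 * 1"
          proof (intro mult_mono)
            show "\<delta> ^ ?d \<le> \<delta> ^ 1" using \<open>?d \<noteq> 0\<close> \<delta> by (intro power_decreasing) auto
            have "real n powr (real (m - i) - \<theta> * real ?d) \<le> real n powr 0"
            proof (rule powr_mono)
              show "real (m - i) - \<theta> * real ?d \<le> 0"
                using gap[OF i] of_nat_diff[OF less_imp_le[OF i(2)], where 'a = real] by linarith
            qed (rule n1)
            then show "real n powr (real (m - i) - \<theta> * real ?d) \<le> 1" using n1 by simp
          qed (use \<delta> in auto)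
          finally show ?thesis by (simp add: E_def \<delta>_def)
        qed
        show "1 \<le> 1 / \<kappa> * (real b ^ i * q ^ early_count l r s i)" if "i \<le> m" for i
          using weight[OF that E_D[OF that] \<theta>E[OF that]] \<kappa> by (simp add: E_def pos_le_divide_eq)
        show "D = (l + m choose s) - (l choose s)" by (simp add: D_def)
        show "0 \<le> 1 / \<kappa>" using \<kappa> by simp
        show "\<mu> = real b ^ m * q ^ D" by (rule \<mu>_def)
        show "0 < \<mu>" using \<kappa> \<mu> by simp
      qed
      moreover have "c2 \<le> \<mu> / (4 * (1 + 2 ^ m * (1 / \<kappa>) * \<mu>))"
      proof -
        have "\<kappa> + 2 ^ m * \<mu> \<le> \<mu> * (1 + 2 ^ m)" using \<mu> by (simp add: algebra_simps)
        moreover have "0 < \<kappa> + 2 ^ m * \<mu>" using \<kappa> \<mu> by (intro add_pos_pos mult_pos_pos) auto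
        moreover have "(4 * (1 + 2 ^ m * (1 / \<kappa>) * \<mu>)) = 4 * ((\<kappa> + 2 ^ m * \<mu>) / \<kappa>)"
          using \<kappa> by (simp add: field_simps)
        moreover have "0 < (1 :: real) + 2 ^ m" by (simp add: add_pos_pos)
        ultimately show ?thesis
          using \<kappa> unfolding c2_def by (simp add: divide_simps) (simp add: algebra_simps)
      qed
      ultimately show ?thesis using order_trans by blast
    qed
    obtain t1 \<sigma> where \<sigma>: "admissible n r s \<sigma>" "real t1 \<le> C1 * real n powr (real r - \<theta>)"
        "c1 \<le> success n r s l \<sigma> t1"
      using ach[OF n(1)] by blast
    obtain \<rho> where \<rho>: "admissible n r s \<rho>" "c1 * c2 \<le> success n r s (l + m) \<rho> (t1 + D * T)"
      using success_compose[OF less_imp_le[OF rs(2)] n(3) \<sigma>(1,3) ext less_imp_le[OF c2]] by blast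
    have "real D * real T \<le> real D * real n powr (real r - \<theta>)"
      using T(3) by (intro mult_left_mono) auto
    then have "real (t1 + D * T) \<le> (C1 + real D) * real n powr (real r - \<theta>)"
      using \<sigma>(2) by (simp add: algebra_simps)
    then show "\<exists>t \<sigma>. admissible n r s \<sigma> \<and> real t \<le> (C1 + real D) * real n powr (real r - \<theta>) \<and>
        c1 * c2 \<le> success n r s (l + m) \<sigma> t"
      using \<rho> by blast
  qed
qed

section \<open>Recursion over core cliques\<close>

lemma ell_properties:
  assumes "r \<le> k"
  shows "ell k r s \<le> k - r" "ell_expr k r s (ell k r s) \<le> 0"
proof -
  \<comment> \<open>At k - r the linear part and all bracketed differences vanish, so the minimum
    exists and leaves at least \<open>r\<close> new vertices.\<close>
  have "ell_expr k r s (k - r) \<le> 0" using assms by (simp add: ell_expr_def of_nat_diff)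
  then show "ell k r s \<le> k - r" "ell_expr k r s (ell k r s) \<le> 0"
    unfolding ell_def by (rule Least_le, rule LeastI)
qed

text \<open>Strong induction on \<open>k\<close>. A core with fewer than \<open>s\<close> vertices
  is free, one with \<open>s\<close> vertices is a single edge, and a larger one comes from the
  induction hypothesis, whose exponent is no larger by \<open>theta_antimono\<close>.\<close>

lemma achievable_clique:
  assumes "2 \<le> r" "r < s" "s < k"
  shows "achievable r s k (real r - theta k (ell k r s) s)"
  using assms(3)
proof (induction k rule: less_induct)
  case (less k)
  define l where "l = ell k r s"
  define m where "m = k - l"
  have l: "l \<le> k - r" "ell_expr k r s l \<le> 0"
    unfolding l_def using ell_properties[of r k s] less.prems assms by auto
  have k: "k = l + m" "r \<le> m" using l(1) less.prems assms by (auto simp: m_def)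
  have "l < k" using k assms by simp
  have \<theta>1: "theta k l s \<le> 1" using less.prems assms \<open>l < k\<close> by (intro theta_le_1) auto
  have core: "achievable r s l (real r - theta k l s)"
  proof (cases l s rule: linorder_cases)
    case less
    then show ?thesis using assms by (intro achievable_small)
  next
    case equal
    then show ?thesis using achievable_single_edge[of r s] assms \<theta>1 by auto
  next
    case greater
    have "ell l r s < l" using ell_properties(1)[of r l s] greater assms by linarith
    then have "theta k l s \<le> theta l (ell l r s) s"
      using greater assms \<open>l < k\<close> by (intro theta_antimono) auto
    then show ?thesis
      using less.IH[OF \<open>l < k\<close> greater] by (elim achievable_mono) simp
  qed
  have "real m - real r \<le> theta k l s * (real (early_count l r s m) - real (early_count l r s r))"
  proof -
    have "(\<Sum>j=1..r. real (l choose (s - j)) * (real ((k - l) choose j) - real (r choose j)))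
      = real (early_count l r s m) - real (early_count l r s r)"
      by (simp add: early_count_def sum_subtractf right_diff_distrib m_def)
    then show ?thesis using l(2) k(1) by (simp add: ell_expr_def theta_def)
  qed
  then have "achievable r s (l + m) (real r - theta (l + m) l s)"
    using less.prems core k(2)
    by (intro achievable_extend assms(1,2)) (simp_all only: k(1)[symmetric])
  then show ?case unfolding k(1)[symmetric] unfolding l_def .
qed

theorem theorem7:
  fixes r s k :: nat
  assumes "2 \<le> r" and "r < s" and "s \<le> k"
  shows "\<exists>S. valid_strategy r s S \<and>
    (\<forall>t :: nat \<Rightarrow> nat.
       (\<lambda>n. real n powr (real r - (real k - real (ell k r s)) /
              (real (k choose s) - real (ell k r s choose s))))
         \<in> o(\<lambda>n. real (t n)) \<longrightarrow>
       ((\<lambda>n. clique_prob r s k S n (t n)) \<longlongrightarrow> 1) at_top)"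
proof (cases "k = s")
  \<comment> \<open>For k = s the fraction is s - \<ell> >= r, so the exponent is at most 0 and this
    case is separate from the general bound.\<close>
  case True
  then show ?thesis using single_edge_strategy[OF assms(2)] by simp
next
  case False
  then have "s < k" using assms by simp
  have "ell k r s < k" using ell_properties(1)[of r k s] assms by linarith
  then have "theta k (ell k r s) s \<le> 1" using assms \<open>s < k\<close> by (intro theta_le_1) auto
  then have "0 \<le> real r - theta k (ell k r s) s" using assms by simp
  from achievable_imp_strategy[OF achievable_clique[OF assms(1,2) \<open>s < k\<close>] this assms(2)]
  show ?thesis unfolding theta_def .
qed

end
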